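(* Let $D\subset\mathbb{R}^n$, $n\geq 3$, be an open set with $\rho_{D}<\infty$. Then $$\lambda_1(D)\leq\lambda_1(\mathbb{B})\,\rho_{D}^{-2}.$$
   Context: $\mathbb{B}(x;R)$ is the open ball of radius $R$ centered at $x\in\mathbb{R}^n$, and $\mathbb{B}=\mathbb{B}(0;1)$; $D^c=\mathbb{R}^n\setminus D$. $\lambda_1(D):=\inf\left\{\|\nabla\varphi\|^2_{L^2(D)}/\|\varphi\|^{2}_{L^2(D)} : \varphi\in H^1_0(D)\setminus\{0\}\right\}$, where $H_0^1(D)$ is the closure of $\mathcal{C}_c^\infty(D)$ with respect to the norm $f\mapsto(\|f\|_{L^2(D)}^2+\|\nabla f\|_{L^2(D)}^2)^{1/2}$. (For $D=\emptyset$, read with the conventions $\inf\emptyset=+\infty$, $\sup\emptyset=0$, $0^{-2}=+\infty$.) Newtonian capacity ($n\ge 3$): for a compact set $K\subset\mathbb{R}^n$ let $\mathcal{M}(K)$ be the set of Borel probability measures with support in $K$, and for $\nu\in\mathcal{M}(K)$ let $I(\nu)=\int\int|x-y|^{2-n}\,d\nu(y)\,d\nu(x)\in(0,\infty]$. If $I(\nu)=\infty$ for all $\nu\in\mathcal{M}(K)$, then $\operatorname{cap}(K)=0$; otherwise $\operatorname{cap}(K)=\sup\{1/I(\nu):\nu\in\mathcal{M}(K)\}$. For a Borel set $E\subset\mathbb{R}^n$, $\operatorname{cap}(E)=\sup\{\operatorname{cap}(K): K\subset E\text{ compact}\}$. Strict Newtonian capacity inradius: $\rho_{D}:=\sup\{R\geq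 0 : \forall\epsilon>0\ \exists x\in D:\ \operatorname{cap}(\mathbb{B}(x;R)\cap D^c)<\epsilon\}$. *)

theory Defs
  imports "HOL-Probability.Probability"
begin

section \<open>The Sobolev space $H^1_0(D)$ and the first Dirichlet eigenvalue\<close>

primrec C_k :: "nat \<Rightarrow> ('a::euclidean_space \<Rightarrow> real) \<Rightarrow> bool" where
  "C_k 0 f \<longleftrightarrow> continuous_on UNIV f"
| "C_k (Suc k) f \<longleftrightarrow> f differentiable_on UNIV \<and>
     (\<forall>b\<in>Basis. C_k k (\<lambda>x. frechet_derivative f (at x) b))"

definition gradient :: "('a::euclidean_space \<Rightarrow> real) \<Rightarrow> 'a \<Rightarrow> 'a" where
  "gradient f x = (\<Sum>b\<in>Basis. frechet_derivative f (at x) b *\<^sub>R b)"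

text \<open>$C_c^\infty(D)$ for open \<open>D\<close>; its elements are represented by their (smooth) extension
  by zero to the whole space.\<close>

definition test_functions :: "'a::euclidean_space set \<Rightarrow> ('a \<Rightarrow> real) set" where
  "test_functions D =
     {f. (\<forall>k. C_k k f) \<and> compact (closure {x. f x \<noteq> 0}) \<and> closure {x. f x \<noteq> 0} \<subseteq> D}"

text \<open>Functions in $L^2(D)$, real- or vector-valued, are total functions of which only the
  restriction to \<open>D\<close> matters; almost everywhere equal functions are not identified.\<close>

definition L2_on :: "'a::euclidean_space set \<Rightarrow> ('a \<Rightarrow> 'b::real_normed_vector) set" where
  "L2_on D = {f. f \<in> borel_measurable (lebesgue_on D) \<and>
                 integrable (lebesgue_on D) (\<lambda>x. (norm (f x))\<^sup>2)}"

definition L2_norm_on :: "'a::euclidean_space set \<Rightarrow> ('a \<Rightarrow> 'b::real_normed_vector) \<Rightarrow> real" where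
  "L2_norm_on D f = sqrt (LINT x|lebesgue_on D. (norm (f x))\<^sup>2)"

definition weak_gradient :: "'a::euclidean_space set \<Rightarrow> ('a \<Rightarrow> real) \<Rightarrow> ('a \<Rightarrow> 'a) \<Rightarrow> bool" where
  "weak_gradient D u g \<longleftrightarrow>
     (\<forall>\<phi>\<in>test_functions D.
        (LINT x|lebesgue_on D. u x *\<^sub>R gradient \<phi> x) = - (LINT x|lebesgue_on D. \<phi> x *\<^sub>R g x))"

text \<open>Elements of $H^1(D)$ are represented by pairs \<open>(u, g)\<close> of a function and its weak gradient
  (which \<open>u\<close> determines almost everywhere in \<open>D\<close>).\<close>

definition H1 :: "'a::euclidean_space set \<Rightarrow> (('a \<Rightarrow> real) \<times> ('a \<Rightarrow> 'a)) set" where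
  "H1 D = {(u, g). u \<in> L2_on D \<and> g \<in> L2_on D \<and> weak_gradient D u g}"

definition H1_norm :: "'a::euclidean_space set \<Rightarrow> ('a \<Rightarrow> real) \<Rightarrow> ('a \<Rightarrow> 'a) \<Rightarrow> real" where
  "H1_norm D u g = sqrt ((L2_norm_on D u)\<^sup>2 + (L2_norm_on D g)\<^sup>2)"

definition H1_0 :: "'a::euclidean_space set \<Rightarrow> (('a \<Rightarrow> real) \<times> ('a \<Rightarrow> 'a)) set" where
  "H1_0 D = {(u, g) \<in> H1 D. \<exists>\<phi>::nat \<Rightarrow> 'a \<Rightarrow> real. (\<forall>k. \<phi> k \<in> test_functions D) \<and>
     (\<lambda>k. H1_norm D (\<lambda>x. \<phi> k x - u x) (\<lambda>x. gradient (\<phi> k) x - g x)) \<longlonglongrightarrow> 0}"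

text \<open>With values in \<open>ennreal\<close>, the infimum of the empty set is \<open>\<infinity>\<close>; thus \<open>\<lambda>\<^sub>1 {} = \<infinity>\<close>.
  Nonzero elements of $H^1_0(D)$ are those that do not vanish almost everywhere in \<open>D\<close>.\<close>

definition lambda1 :: "'a::euclidean_space set \<Rightarrow> ennreal" ("\<lambda>\<^sub>1") where
  "\<lambda>\<^sub>1 D = Inf {ennreal ((L2_norm_on D g)\<^sup>2 / (L2_norm_on D u)\<^sup>2) | u g.
     (u, g) \<in> H1_0 D \<and> \<not> (AE x in lebesgue_on D. u x = 0)}"


section \<open>Newtonian capacity and the strict capacity inradius\<close>

definition measure_support :: "'a::topological_space measure \<Rightarrow> 'a set" where
  "measure_support \<nu> = {x. \<forall>U. open U \<and> x \<in> U \<longrightarrow> emeasure \<nu> U > 0}"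

definition prob_measures_on :: "'a::topological_space set \<Rightarrow> 'a measure set" where
  "prob_measures_on K = {\<nu>. sets \<nu> = sets borel \<and> prob_space \<nu> \<and> measure_support \<nu> \<subseteq> K}"

text \<open>The Newtonian kernel $|x-y|^{2-n}$, meaningful for dimension $n \geq 3$. On the diagonal it is
  \<open>\<infinity>\<close>, since \<open>inverse 0 = \<infinity>\<close> in \<open>ennreal\<close>.\<close>

definition newton_kernel :: "'a::euclidean_space \<Rightarrow> 'a \<Rightarrow> ennreal" where
  "newton_kernel x y = inverse (ennreal (norm (x - y)) ^ (DIM('a) - 2))"

definition energy :: "'a::euclidean_space measure \<Rightarrow> ennreal" where
  "energy \<nu> = (\<integral>\<^sup>+x. (\<integral>\<^sup>+y. newton_kernel x y \<partial>\<nu>) \<partial>\<nu>)"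

definition cap_compact :: "'a::euclidean_space set \<Rightarrow> ennreal" where
  "cap_compact K =
     (if \<forall>\<nu>\<in>prob_measures_on K. energy \<nu> = \<infinity> then 0
      else SUP \<nu>\<in>prob_measures_on K. 1 / energy \<nu>)"

definition cap :: "'a::euclidean_space set \<Rightarrow> ennreal" where
  "cap E = (SUP K\<in>{K. compact K \<and> K \<subseteq> E}. cap_compact K)"

definition strict_cap_inradius :: "'a::euclidean_space set \<Rightarrow> ennreal" ("\<rho>") where
  "\<rho> D = Sup {ennreal R | R. R \<ge> 0 \<and>
     (\<forall>\<epsilon>>0. \<exists>x\<in>D. cap (ball x R \<inter> - D) < ennreal \<epsilon>)}"

end

theory Submission
  imports Defs
begin

text \<open>Let \<open>\<phi>\<close> be a test function on the unit ball with Rayleigh quotient close to \<open>\<lambda>\<^sub>1\<close>, scaled to a ball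
  \<open>ball x R\<close> whose intersection \<open>F\<close> with the support of \<open>\<phi>\<close> and the complement of \<open>D\<close> has small
  capacity. Nearly minimising the energy of a regularised kernel among finitely
  supported probabilities on \<open>F\<close> yields a smooth superharmonic potential \<open>g \<ge> 0\<close> with \<open>g > 1\<close> on \<open>F\<close> and
  small total mass, hence small integral over the ball. For a smooth cutoff \<open>\<eta>\<close> with \<open>\<eta> 0 = 1\<close> that
  vanishes on \<open>[1, \<infinity>)\<close>, the product of \<open>\<phi>\<close> and \<open>\<eta> \<circ> g\<close> is a test function on \<open>D\<close>. Both
  \<open>1 - \<eta> \<circ> g\<close> and, by superharmonicity, the part of the gradient that comes from \<open>g\<close> are controlled in
  $L^2$ by the integral of \<open>g\<close>, so its Rayleigh quotient is hardly larger than that of \<open>\<phi>\<close>.\<close>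

section \<open>Smooth functions\<close>

text \<open>The cutoff must vanish at every point of \<open>F\<close>, whereas a Newtonian
  equilibrium potential is in general neither smooth nor large at each single point of the set.
  Since \<open>kern d\<close> is smooth and bounded, a first-variation argument applies at every
  point, and a near-minimiser suffices. After that, no estimate may depend on \<open>d\<close> or
  \<open>F\<close>. The potential enters only through its sign, its superharmonicity and its
  integral over the unit ball. In particular there is no upper bound for \<open>g\<close>; the
  weight \<open>exp (- g)\<close> replaces it, and it is bounded below on \<open>g < 1\<close>, the
  only place where the derivative of the cutoff is nonzero. The error constant depends on \<phi>
  alone. Hence \<phi> is fixed first, the ball is chosen afterwards, and the capacity may then tend
  to 0.\<close>

abbreviation smooth :: "('a::euclidean_space \<Rightarrow> real) \<Rightarrow> bool"
  where "smooth f \<equiv> \<forall>k. C_k k f"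

abbreviation dd :: "('a::euclidean_space \<Rightarrow> real) \<Rightarrow> 'a \<Rightarrow> 'a \<Rightarrow> real"
  where "dd f b x \<equiv> frechet_derivative f (at x) b"

definition lap :: "('a::euclidean_space \<Rightarrow> real) \<Rightarrow> 'a \<Rightarrow> real"
  where "lap f x = (\<Sum>b\<in>Basis. dd (dd f b) b x)"

lemma dd_eq: "(f has_derivative f') (at x) \<Longrightarrow> dd f b x = f' b"
  using frechet_derivative_at by metis

lemma C_k_SucI:
  assumes "\<And>x. (f has_derivative f' x) (at x)" "\<And>b. b \<in> Basis \<Longrightarrow> C_k k (\<lambda>x. f' x b)"
  shows "C_k (Suc k) f"
proof -
  have "dd f b = (\<lambda>x. f' x b)" for b using dd_eq[OF assms(1)] by auto
  then show ?thesis using assms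
    by (auto simp: differentiable_on_def differentiable_def intro: has_derivative_at_withinI)
qed

lemma C_k_has_derivative: "C_k (Suc k) f \<Longrightarrow> (f has_derivative frechet_derivative f (at x)) (at x)"
  using frechet_derivative_works by (auto simp: differentiable_on_def)

lemma C_k_mono: "C_k (Suc k) f \<Longrightarrow> C_k k f"
proof (induction k arbitrary: f)
  case 0
  then show ?case by (auto intro: differentiable_imp_continuous_on)
next
  case (Suc k)
  then show ?case using C_k.simps(2) by metis
qed

lemma C_k_continuous: "C_k k f \<Longrightarrow> continuous_on UNIV f"
  by (cases k) (auto intro: differentiable_imp_continuous_on)

lemma smooth_continuous: "smooth f \<Longrightarrow> continuous_on A f"
  using C_k_continuous continuous_on_subset by blast

lemma smooth_has_derivative: "smooth f \<Longrightarrow> (f has_derivative frechet_derivative f (at x)) (at x)"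
  using C_k_has_derivative by blast

lemma smooth_dd: "smooth f \<Longrightarrow> b \<in> Basis \<Longrightarrow> smooth (dd f b)"
  using C_k.simps(2) by blast

lemma C_k_const [simp]: "C_k k (\<lambda>x. c)"
proof (induction k arbitrary: c)
  case (Suc k)
  show ?case by (rule C_k_SucI[where f'="\<lambda>_ _. 0"]) (auto intro: derivative_eq_intros Suc)
qed simp

lemma C_k_inner [simp]: "C_k k (\<lambda>x. x \<bullet> a)"
proof (cases k)
  case (Suc k)
  show ?thesis unfolding Suc
    by (rule C_k_SucI[where f'="\<lambda>_ h. h \<bullet> a"]) (auto intro!: derivative_eq_intros)
qed (auto intro!: continuous_intros)

lemma C_k_add: "C_k k f \<Longrightarrow> C_k k g \<Longrightarrow> C_k k (\<lambda>x. f x + g x)"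
proof (induction k arbitrary: f g)
  case (Suc k)
  show ?case
  proof (rule C_k_SucI)
    show "((\<lambda>x. f x + g x) has_derivative (\<lambda>h. dd f h x + dd g h x)) (at x)" for x
      by (intro has_derivative_add C_k_has_derivative[OF Suc.prems(1)] C_k_has_derivative[OF Suc.prems(2)])
  qed (use Suc in auto)
qed (auto intro!: continuous_intros)

lemma C_k_mult: "C_k k f \<Longrightarrow> C_k k g \<Longrightarrow> C_k k (\<lambda>x. f x * g x)"
proof (induction k arbitrary: f g)
  case (Suc k)
  have "C_k k (\<lambda>x. f x * dd g b x + dd f b x * g x)" if "b \<in> Basis" for b
    using Suc.prems that C_k_mono by (auto intro!: C_k_add Suc.IH)
  moreover have "((\<lambda>x. f x * g x) has_derivative (\<lambda>h. f x * dd g h x + dd f h x * g x)) (at x)" for x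
    by (intro has_derivative_mult C_k_has_derivative[OF Suc.prems(1)] C_k_has_derivative[OF Suc.prems(2)])
  ultimately show ?case by (intro C_k_SucI)
qed (auto intro!: continuous_intros)

lemma C_k_sum: "(\<And>i. i \<in> I \<Longrightarrow> C_k k (f i)) \<Longrightarrow> C_k k (\<lambda>x. \<Sum>i\<in>I. f i x)"
  by (induction I rule: infinite_finite_induct) (auto intro: C_k_add)

lemma C_k_affine:
  assumes "C_k k f" shows "C_k k (\<lambda>x. f (r *\<^sub>R x + a))"
  using assms
proof (induction k arbitrary: f)
  case 0
  then have "continuous_on UNIV (f \<circ> (\<lambda>x. r *\<^sub>R x + a))"
    by (intro continuous_on_compose continuous_on_add continuous_on_scaleR continuous_on_const
        continuous_on_id) (auto intro: continuous_on_subset)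
  then show ?case by (simp add: o_def)
next
  case (Suc k)
  have "((\<lambda>x. f (r *\<^sub>R x + a)) has_derivative (\<lambda>h. r * dd f h (r *\<^sub>R x + a))) (at x)" for x
  proof -
    have 1: "((\<lambda>x. f (r *\<^sub>R x + a)) has_derivative (\<lambda>h. dd f (r *\<^sub>R h) (r *\<^sub>R x + a))) (at x)"
      by (rule has_derivative_compose[where g=f, OF _ C_k_has_derivative[OF Suc.prems]])
         (auto intro!: derivative_eq_intros)
    have "linear (frechet_derivative f (at (r *\<^sub>R x + a)))"
      using C_k_has_derivative[OF Suc.prems] has_derivative_linear by blast
    from linear_scale[OF this] 1 show ?thesis by simp
  qed
  moreover have "C_k k (\<lambda>x. r * dd f b (r *\<^sub>R x + a))" if "b \<in> Basis" for b
    using Suc.IH[of "dd f b"] Suc.prems that by (intro C_k_mult C_k_const) auto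
  ultimately show ?case by (intro C_k_SucI)
qed

text \<open>The class \<open>G\<close>, closed under differentiation on \<open>T\<close>, carries
  the induction: a derivative of g o h is g' o h times a derivative of h, with g' again in
  \<open>G\<close>. Powers, exponentials and the flat cutoff thus become smooth without any formula
  for higher derivatives.\<close>

lemma C_k_compose:
  assumes "g \<in> G" and "smooth h" and "\<And>x. h x \<in> T"
    and G: "\<And>g. g \<in> G \<Longrightarrow> \<exists>g'\<in>G. \<forall>t\<in>T. (g has_real_derivative g' t) (at t)"
  shows "C_k k (\<lambda>x. g (h x))"
  using \<open>g \<in> G\<close>
proof (induction k arbitrary: g)
  case 0
  obtain g' where "\<forall>t\<in>T. (g has_real_derivative g' t) (at t)" using G 0 by blast
  then have "continuous_on T g" by (meson DERIV_continuous_on has_field_derivative_at_within)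
  then have "continuous_on UNIV (g \<circ> h)"
    using assms(2,3) by (intro continuous_on_compose) (auto intro: smooth_continuous continuous_on_subset)
  then show ?case by (simp add: o_def)
next
  case (Suc k)
  obtain g' where g': "g' \<in> G" "\<forall>t\<in>T. (g has_real_derivative g' t) (at t)" using G Suc by blast
  have "((\<lambda>x. g (h x)) has_derivative (\<lambda>v. g' (h x) * dd h v x)) (at x)" for x
    using has_derivative_compose[OF smooth_has_derivative[OF assms(2)]
        g'(2)[rule_format, OF assms(3), unfolded has_field_derivative_def]] by simp
  moreover have "C_k k (\<lambda>x. g' (h x) * dd h b x)" if "b \<in> Basis" for b
    using Suc.IH[OF g'(1)] smooth_dd[OF assms(2) that] by (intro C_k_mult) auto
  ultimately show ?case by (intro C_k_SucI)
qed

section \<open>Rules for directional derivatives and the gradient\<close>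

lemma dd_mult:
  assumes "smooth f" "smooth g"
  shows "dd (\<lambda>x. f x * g x) b x = f x * dd g b x + dd f b x * g x"
  by (rule dd_eq) (intro has_derivative_mult smooth_has_derivative assms)

lemma dd_add:
  assumes "smooth f" "smooth g"
  shows "dd (\<lambda>x. f x + g x) b x = dd f b x + dd g b x"
  by (rule dd_eq) (intro has_derivative_add smooth_has_derivative assms)

lemma dd_compose:
  assumes "(g has_real_derivative g') (at (h x))" "smooth h"
  shows "dd (\<lambda>x. g (h x)) b x = g' * dd h b x"
  by (rule dd_eq[OF has_derivative_compose[OF smooth_has_derivative[OF assms(2)]
        assms(1)[unfolded has_field_derivative_def]]])

lemma dd_affine:
  assumes "smooth f"
  shows "dd (\<lambda>x. f (r *\<^sub>R x + a)) b x = r * dd f b (r *\<^sub>R x + a)"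
proof -
  have "((\<lambda>x. f (r *\<^sub>R x + a)) has_derivative (\<lambda>h. dd f (r *\<^sub>R h) (r *\<^sub>R x + a))) (at x)"
    by (rule has_derivative_compose[where g=f, OF _ smooth_has_derivative[OF assms]])
       (auto intro!: derivative_eq_intros)
  moreover have "linear (frechet_derivative f (at (r *\<^sub>R x + a)))"
    using smooth_has_derivative[OF assms] has_derivative_linear by blast
  ultimately show ?thesis using dd_eq linear_scale by fastforce
qed

lemma dd_inner [simp]: "dd (\<lambda>x. x \<bullet> a) b x = b \<bullet> a"
  by (rule dd_eq) (auto intro!: derivative_eq_intros)

lemma gradient_inner: "b \<in> Basis \<Longrightarrow> gradient f x \<bullet> b = dd f b x"
  by (simp add: gradient_def inner_sum_left inner_Basis if_distrib cong: if_cong)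

lemma norm_gradient_sq: "(norm (gradient f x))\<^sup>2 = (\<Sum>b\<in>Basis. (dd f b x)\<^sup>2)"
  unfolding power2_norm_eq_inner euclidean_inner[of "gradient f x" "gradient f x"]
  by (simp add: gradient_inner power2_eq_square)

text \<open>Leads from the restricted Lebesgue measure of the definitions to \<open>lborel\<close>,
  where translation and scaling are available.\<close>

lemma lebesgue_on_open:
  fixes f :: "'a::euclidean_space \<Rightarrow> 'b::euclidean_space"
  assumes "open D" and [measurable]: "f \<in> borel_measurable borel" and 0: "\<And>x. x \<notin> D \<Longrightarrow> f x = 0"
  shows "(LINT x|lebesgue_on D. f x) = (LINT x|lborel. f x)"
    and "integrable (lebesgue_on D) f \<longleftrightarrow> integrable lborel f"
proof -
  have D: "D \<in> sets lebesgue" using assms(1) by auto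
  have f: "(\<lambda>x. indicator D x *\<^sub>R f x) = f" using 0 by (auto simp: indicator_def)
  show "(LINT x|lebesgue_on D. f x) = (LINT x|lborel. f x)"
    using D by (simp add: integral_restrict_space f integral_completion)
  show "integrable (lebesgue_on D) f \<longleftrightarrow> integrable lborel f"
    using D by (simp add: integrable_restrict_space f integrable_completion)
qed

section \<open>Integration by parts for compactly supported functions\<close>

lemma integrable_compact_support:
  fixes f :: "'a::euclidean_space \<Rightarrow> 'b::{banach, second_countable_topology}"
  assumes "continuous_on UNIV f" "compact K" "\<And>x. x \<notin> K \<Longrightarrow> f x = 0"
  shows "integrable lborel f"
proof -
  have "(\<lambda>x. indicator K x *\<^sub>R f x) = f" using assms(3) by (auto simp: indicator_def)
  then show ?thesis
    using borel_integrable_compact[OF assms(2) continuous_on_subset[OF assms(1)]] by simp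
qed

lemma bounded_compact_support:
  fixes f :: "'a::euclidean_space \<Rightarrow> 'b::euclidean_space"
  assumes "continuous_on UNIV f" "compact K" "\<And>x. x \<notin> K \<Longrightarrow> f x = 0"
  obtains C where "0 \<le> C" "\<And>x. norm (f x) \<le> C"
proof -
  have "compact (f ` K)" using assms by (meson compact_continuous_image continuous_on_subset subset_UNIV)
  then obtain C where C: "\<forall>y\<in>f ` K. norm y \<le> C" using compact_imp_bounded bounded_iff by blast
  have "norm (f x) \<le> max C 0" for x
    using C assms(3)[of x] by (cases "x \<in> K") force+
  then show ?thesis using that[of "max C 0"] by auto
qed

lemma dd_eq_0_outside:
  assumes "closed K" "\<And>x. x \<notin> K \<Longrightarrow> f x = 0" "x \<notin> K"
  shows "dd f b x = 0"
proof -
  have "((\<lambda>_. 0) has_derivative (\<lambda>_. 0)) (at x)" by simp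
  then have "(f has_derivative (\<lambda>_. 0)) (at x)"
    by (rule has_derivative_transform_within_open[where s="-K"]) (use assms in auto)
  then show ?thesis by (rule dd_eq)
qed

lemma lap_eq_0_outside:
  assumes "compact K" "\<And>x. x \<notin> K \<Longrightarrow> f x = 0" "x \<notin> K"
  shows "lap f x = 0"
proof -
  have K: "closed K" using assms(1) by (rule compact_imp_closed)
  have "dd (dd f b) b x = 0" for b
    by (rule dd_eq_0_outside[of K "dd f b" x b, OF K _ assms(3)])
       (rule dd_eq_0_outside[of K f _ b, OF K assms(2)])
  then show ?thesis by (simp add: lap_def)
qed

lemma continuous_on_lap: "smooth f \<Longrightarrow> continuous_on A (lap f)"
  unfolding lap_def by (intro continuous_on_sum smooth_continuous smooth_dd)

text \<open>The difference quotients of \<open>f\<close> in direction \<open>b\<close> have integral zero, by translation invariance,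
  and converge boundedly.\<close>

lemma integral_dd_eq_0:
  fixes f :: "'a::euclidean_space \<Rightarrow> real"
  assumes "C_k (Suc 0) f" "compact K" "\<And>x. x \<notin> K \<Longrightarrow> f x = 0" "b \<in> Basis"
  shows "(LINT x|lborel. dd f b x) = 0"
proof -
  have d: "(f has_derivative frechet_derivative f (at x)) (at x)" for x
    using C_k_has_derivative[OF assms(1)] .
  have cf: "continuous_on UNIV f" using assms(1) C_k_continuous by blast
  have cd: "continuous_on UNIV (dd f b)" using assms(1,4) by simp
  have d0: "x \<notin> K \<Longrightarrow> dd f b x = 0" for x
    using dd_eq_0_outside[of K f x b] assms compact_imp_closed by blast
  obtain C where C: "0 \<le> C" "\<And>x. norm (dd f b x) \<le> C"
    using bounded_compact_support[OF cd assms(2) d0] by blast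
  define s where "s m x = (f (x + (1 / real (Suc m)) *\<^sub>R b) - f x) * real (Suc m)" for m x
  \<comment> \<open>The union of the translates of \<open>K\<close> by \<open>- t b\<close> with t
    in [0, 1] contains the supports of all difference quotients \<open>s m\<close>. Together with
    the mean value bound \<open>C\<close> it yields one dominating function for every m.\<close>
  define K' where "K' = (\<lambda>(x, t). x - t *\<^sub>R b) ` (K \<times> {0..1::real})"
  have K': "compact K'" unfolding K'_def
    by (intro compact_continuous_image compact_Times assms compact_Icc)
       (auto intro!: continuous_intros simp: case_prod_beta)
  have line: "((\<lambda>t. f (x + t *\<^sub>R b)) has_real_derivative dd f b (x + t *\<^sub>R b)) (at t)" for x t
  proof -
    have "((\<lambda>t. f (x + t *\<^sub>R b)) has_derivative (\<lambda>h. dd f (h *\<^sub>R b) (x + t *\<^sub>R b))) (at t)"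
      by (rule has_derivative_compose[where g=f, OF _ d]) (auto intro!: derivative_eq_intros)
    then show ?thesis
      using linear_scale[OF has_derivative_linear[OF d]]
      by (simp add: has_field_derivative_def mult_commute_abs)
  qed
  have bd: "\<bar>f (x + h *\<^sub>R b) - f x\<bar> \<le> C * h" if "0 < h" for x h
  proof -
    have "\<exists>z>0. z < h \<and> f (x + h *\<^sub>R b) - f (x + 0 *\<^sub>R b) = (h - 0) * dd f b (x + z *\<^sub>R b)"
      by (rule MVT2) (use that line in auto)
    then obtain z where "f (x + h *\<^sub>R b) - f (x + 0 *\<^sub>R b) = (h - 0) * dd f b (x + z *\<^sub>R b)"
      by blast
    then show ?thesis using C(2)[of "x + z *\<^sub>R b"] that by (simp add: abs_mult mult.commute mult_left_mono)
  qed
  have s_bd: "norm (s m x) \<le> indicator K' x * C" for m x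
  proof (cases "x \<in> K'")
    case True
    have "\<bar>f (x + (1 / real (Suc m)) *\<^sub>R b) - f x\<bar> * real (Suc m) \<le> C * (1 / real (Suc m)) * real (Suc m)"
      by (intro mult_right_mono bd) auto
    then show ?thesis using True by (simp add: s_def abs_mult)
  next
    case False
    have "f (x + t *\<^sub>R b) = 0" if "0 \<le> t" "t \<le> 1" for t
    proof -
      have "x + t *\<^sub>R b \<notin> K"
        using False that by (force simp: K'_def image_iff)
      then show ?thesis using assms(3) by blast
    qed
    from this[of "1 / real (Suc m)"] this[of 0] show ?thesis by (simp add: s_def False)
  qed
  have int_f: "integrable lborel f" by (rule integrable_compact_support[OF cf assms(2,3)])
  have mf[measurable]: "f \<in> borel_measurable borel" using cf by (rule borel_measurable_continuous_onI)
  have md[measurable]: "dd f b \<in> borel_measurable borel" using cd by (rule borel_measurable_continuous_onI)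
  have tr: "(LINT x|lborel. f (x + a)) = (LINT x|lborel. f x)" "integrable lborel (\<lambda>x. f (x + a))" for a
  proof -
    have l: "distr lborel borel (\<lambda>x. x + a) = (lborel :: 'a measure)"
    proof -
      have "(\<lambda>x. x + a) = (+) a" by (simp add: fun_eq_iff add.commute)
      then show ?thesis using lborel_distr_plus[of a] by simp
    qed
    show "(LINT x|lborel. f (x + a)) = (LINT x|lborel. f x)"
      by (subst (2) l[symmetric]) (simp add: integral_distr)
    show "integrable lborel (\<lambda>x. f (x + a))"
      using int_f by (subst (asm) l[symmetric]) (simp add: integrable_distr_eq)
  qed
  have "(\<lambda>m. LINT x|lborel. s m x) \<longlonglongrightarrow> (LINT x|lborel. dd f b x)"
  proof (rule integral_dominated_convergence[where w="\<lambda>x. indicator K' x * C"])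
    show "integrable lborel (\<lambda>x. indicator K' x * C)"
      using borel_integrable_compact[OF K', of "\<lambda>_. C"] by simp
    show "AE x in lborel. (\<lambda>m. s m x) \<longlonglongrightarrow> dd f b x"
    proof (rule AE_I2)
      fix x
      have "((\<lambda>h. (f (x + h *\<^sub>R b) - f x) / h) \<longlongrightarrow> dd f b x) (at 0)"
        using line[of x 0] by (simp add: DERIV_def)
      then have "((\<lambda>m. (f (x + (1 / real (Suc m)) *\<^sub>R b) - f x) / (1 / real (Suc m))) \<longlonglongrightarrow> dd f b x)"
        by (rule filterlim_compose[OF _ filterlim_atI])
           (use LIMSEQ_Suc[OF lim_1_over_n] in auto)
      then show "(\<lambda>m. s m x) \<longlonglongrightarrow> dd f b x" by (simp add: s_def)
    qed
    show "s m \<in> borel_measurable lborel" for m unfolding s_def by measurable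
  qed (use s_bd md in auto)
  moreover have "(LINT x|lborel. s m x) = 0" for m
    unfolding s_def by (simp add: tr int_f del: of_nat_Suc)
  ultimately show ?thesis by (simp add: LIMSEQ_const_iff)
qed

text \<open>For each basis vector b, \<open>f * dd (dd g b) b - g * dd (dd f b) b\<close> is the
  b-derivative of \<open>f * dd g b - g * dd f b\<close>. This field inherits its compact support
  from \<open>f\<close>, so the integral of its derivative is zero, whatever the growth of
  \<open>g\<close>.\<close>

lemma green:
  fixes f g :: "'a::euclidean_space \<Rightarrow> real"
  assumes f: "smooth f" and g: "smooth g" and K: "compact K" "\<And>x. x \<notin> K \<Longrightarrow> f x = 0"
  shows "(LINT x|lborel. f x * lap g x) = (LINT x|lborel. g x * lap f x)"
proof -
  have d0: "x \<notin> K \<Longrightarrow> dd f b x = 0" for x b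
    using dd_eq_0_outside[of K f x b] K compact_imp_closed by blast
  have dd0: "x \<notin> K \<Longrightarrow> dd (dd f b) b x = 0" for x b
    using dd_eq_0_outside[of K "dd f b" x b] d0 K compact_imp_closed by blast
  have int: "integrable lborel (\<lambda>x. f x * dd (dd g b) b x)" "integrable lborel (\<lambda>x. g x * dd (dd f b) b x)"
    if "b \<in> Basis" for b
    by (rule integrable_compact_support[OF _ K(1)],
        intro continuous_on_mult smooth_continuous smooth_dd f g that, simp add: K dd0)+
  have "(LINT x|lborel. f x * dd (dd g b) b x) = (LINT x|lborel. g x * dd (dd f b) b x)"
    if b: "b \<in> Basis" for b
  proof -
    define F where "F x = f x * dd g b x + (-1) * (g x * dd f b x)" for x
    have F: "smooth F" unfolding F_def
      by (intro allI C_k_add C_k_mult C_k_const f[rule_format] g[rule_format]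
          smooth_dd[OF f b, rule_format] smooth_dd[OF g b, rule_format])
    have sm: "smooth (\<lambda>x. f x * dd g b x)" "smooth (\<lambda>x. g x * dd f b x)"
      by (intro allI C_k_mult f[rule_format] g[rule_format]
          smooth_dd[OF f b, rule_format] smooth_dd[OF g b, rule_format])+
    have sm': "smooth (\<lambda>x. (-1) * (g x * dd f b x))"
      by (intro allI C_k_mult[OF C_k_const]) (use sm in auto)
    have "dd F b x = f x * dd (dd g b) b x - g x * dd (dd f b) b x" for x
      unfolding F_def dd_add[OF sm(1) sm'] dd_mult[OF allI[OF C_k_const] sm(2)]
        dd_mult[OF f smooth_dd[OF g b]] dd_mult[OF g smooth_dd[OF f b]]
      by (simp add: dd_eq[OF has_derivative_const])
    moreover have "(LINT x|lborel. dd F b x) = 0"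
      using integral_dd_eq_0[OF F[rule_format] K(1) _ b] by (simp add: F_def K d0)
    ultimately show ?thesis using int[OF b] by simp
  qed
  then show ?thesis
    unfolding lap_def sum_distrib_left using int by (simp add: Bochner_Integration.integral_sum)
qed

section \<open>Test functions and the Rayleigh quotient\<close>

text \<open>For a test function on an open set, this and \<open>dirichlet\<close> are the two terms
  of its Rayleigh quotient. Integrating over the whole space detaches them from the set, so that
  functions supported in different sets can be compared.\<close>

definition sqint :: "('a::euclidean_space \<Rightarrow> real) \<Rightarrow> real"
  where "sqint f = (LINT x|lborel. (f x)\<^sup>2)"

definition dirichlet :: "('a::euclidean_space \<Rightarrow> real) \<Rightarrow> real"
  where "dirichlet f = (LINT x|lborel. (norm (gradient f x))\<^sup>2)"

lemma test_functionsI: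
  assumes "smooth f" "compact K" "K \<subseteq> D" "\<And>x. x \<notin> K \<Longrightarrow> f x = 0"
  shows "f \<in> test_functions D"
proof -
  have "closure {x. f x \<noteq> 0} \<subseteq> K"
    using assms compact_imp_closed by (intro closure_minimal) auto
  moreover from this have "compact (closure {x. f x \<noteq> 0})"
    using assms(2) closed_closure compact_Int_closed inf.absorb2 by metis
  ultimately show ?thesis using assms by (auto simp: test_functions_def)
qed

lemma test_functionsE:
  assumes "f \<in> test_functions D"
  obtains K where "smooth f" "compact K" "K \<subseteq> D" "\<And>x. x \<notin> K \<Longrightarrow> f x = 0"
proof (rule that[of "closure {x. f x \<noteq> 0}"])
  fix x assume "x \<notin> closure {x. f x \<noteq> 0}"
  then show "f x = 0" using closure_subset[of "{x. f x \<noteq> 0}"] by auto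
qed (use assms in \<open>simp_all add: test_functions_def\<close>)

lemma gradient_continuous: "smooth f \<Longrightarrow> continuous_on A (gradient f)"
  unfolding gradient_def
  by (intro continuous_on_sum continuous_on_scaleR continuous_on_const) (rule smooth_continuous[OF smooth_dd])

lemma gradient_eq_0_outside:
  assumes "compact K" "\<And>x. x \<notin> K \<Longrightarrow> f x = 0" "x \<notin> K"
  shows "gradient f x = 0"
proof -
  have "dd f b x = 0" for b
    using dd_eq_0_outside[of K f x b, OF compact_imp_closed[OF assms(1)] assms(2,3)] .
  then show ?thesis by (simp add: gradient_def)
qed

lemma smooth_measurable: "smooth f \<Longrightarrow> f \<in> borel_measurable borel"
  using smooth_continuous borel_measurable_continuous_onI by blast

lemma gradient_measurable: "smooth f \<Longrightarrow> gradient f \<in> borel_measurable borel"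
  using gradient_continuous borel_measurable_continuous_onI by blast

lemma test_function_integrable:
  assumes "f \<in> test_functions D"
  shows "integrable lborel (\<lambda>x. (f x)\<^sup>2)" "integrable lborel (\<lambda>x. (norm (gradient f x))\<^sup>2)"
proof -
  obtain K where K: "smooth f" "compact K" "\<And>x. x \<notin> K \<Longrightarrow> f x = 0"
    using assms by (elim test_functionsE) auto
  show "integrable lborel (\<lambda>x. (f x)\<^sup>2)"
    by (rule integrable_compact_support[OF _ K(2)])
       (intro continuous_on_power smooth_continuous K(1), simp add: K)
  show "integrable lborel (\<lambda>x. (norm (gradient f x))\<^sup>2)"
    by (rule integrable_compact_support[OF _ K(2)])
       (intro continuous_on_power continuous_on_norm gradient_continuous K(1), simp add: gradient_eq_0_outside[of K f, OF K(2,3)])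
qed

lemma L2_norm_on_test_function:
  assumes "open D" "f \<in> test_functions D"
  shows "(L2_norm_on D f)\<^sup>2 = sqint f" "(L2_norm_on D (gradient f))\<^sup>2 = dirichlet f"
    and "f \<in> L2_on D" "gradient f \<in> L2_on D"
proof -
  obtain K where K: "smooth f" "compact K" "K \<subseteq> D" "\<And>x. x \<notin> K \<Longrightarrow> f x = 0"
    using assms by (elim test_functionsE) auto
  have [measurable]: "f \<in> borel_measurable borel" "gradient f \<in> borel_measurable borel"
    using K smooth_measurable gradient_measurable by blast+
  have g0: "x \<notin> D \<Longrightarrow> gradient f x = 0" for x using gradient_eq_0_outside[of K f, OF K(2,4)] K(3) by blast
  have f0: "x \<notin> D \<Longrightarrow> f x = 0" for x using K by blast
  have m: "f \<in> borel_measurable (lebesgue_on D)" "gradient f \<in> borel_measurable (lebesgue_on D)"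
    by (intro measurable_restrict_space1 measurable_completion; simp)+
  have i1: "(LINT x|lebesgue_on D. (norm (f x))\<^sup>2) = sqint f"
    unfolding sqint_def real_norm_def power2_abs
    by (rule lebesgue_on_open[OF assms(1)]) (auto simp: f0)
  have i2: "(LINT x|lebesgue_on D. (norm (gradient f x))\<^sup>2) = dirichlet f"
    unfolding dirichlet_def by (rule lebesgue_on_open[OF assms(1)]) (auto simp: g0)
  show "(L2_norm_on D f)\<^sup>2 = sqint f" "(L2_norm_on D (gradient f))\<^sup>2 = dirichlet f"
    unfolding L2_norm_on_def i1 i2 by (simp_all add: sqint_def dirichlet_def)
  have "integrable (lebesgue_on D) (\<lambda>x. (f x)\<^sup>2)"
    by (subst lebesgue_on_open[OF assms(1)]) (auto simp: f0 test_function_integrable[OF assms(2)])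
  then show "f \<in> L2_on D" using m by (simp add: L2_on_def)
  have "integrable (lebesgue_on D) (\<lambda>x. (norm (gradient f x))\<^sup>2)"
    by (subst lebesgue_on_open[OF assms(1)]) (auto simp: g0 test_function_integrable[OF assms(2)])
  then show "gradient f \<in> L2_on D" using m by (simp add: L2_on_def)
qed

text \<open>The b-component of \<open>f grad h + h grad f\<close> is the b-derivative of the
  compactly supported product \<open>f h\<close>, so its integral vanishes.\<close>

lemma weak_gradient_test_function:
  assumes "open D" "f \<in> test_functions D"
  shows "weak_gradient D f (gradient f)"
  unfolding weak_gradient_def
proof
  fix h assume h: "h \<in> test_functions D"
  obtain K where K: "smooth f" "compact K" "K \<subseteq> D" "\<And>x. x \<notin> K \<Longrightarrow> f x = 0"
    using assms by (elim test_functionsE) auto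
  obtain K' where K': "smooth h" "compact K'" "K' \<subseteq> D" "\<And>x. x \<notin> K' \<Longrightarrow> h x = 0"
    using h by (elim test_functionsE) auto
  have f0: "x \<notin> D \<Longrightarrow> f x = 0" "x \<notin> D \<Longrightarrow> h x = 0" for x using K K' by blast+
  have [measurable]: "f \<in> borel_measurable borel" "gradient f \<in> borel_measurable borel"
    "h \<in> borel_measurable borel" "gradient h \<in> borel_measurable borel"
    using K K' smooth_measurable gradient_measurable by blast+
  have 1: "(LINT x|lebesgue_on D. f x *\<^sub>R gradient h x) = (LINT x|lborel. f x *\<^sub>R gradient h x)"
    by (rule lebesgue_on_open[OF assms(1)]) (auto simp: f0)
  have 2: "(LINT x|lebesgue_on D. h x *\<^sub>R gradient f x) = (LINT x|lborel. h x *\<^sub>R gradient f x)"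
    by (rule lebesgue_on_open[OF assms(1)]) (auto simp: f0)
  have i1: "integrable lborel (\<lambda>x. f x *\<^sub>R gradient h x)"
    by (rule integrable_compact_support[OF _ K(2)])
      (intro continuous_on_scaleR smooth_continuous gradient_continuous K(1) K'(1), simp add: K K')
  have i2: "integrable lborel (\<lambda>x. h x *\<^sub>R gradient f x)"
    by (rule integrable_compact_support[OF _ K'(2)])
      (intro continuous_on_scaleR smooth_continuous gradient_continuous K(1) K'(1), simp add: K K')
  have sm: "smooth (\<lambda>x. f x * h x)" using K(1) K'(1) C_k_mult by blast
  have "(LINT x|lborel. f x *\<^sub>R gradient h x + h x *\<^sub>R gradient f x) = 0"
  proof (rule euclidean_eqI)
    fix b :: 'a assume b: "b \<in> Basis"
    have "(LINT x|lborel. f x *\<^sub>R gradient h x + h x *\<^sub>R gradient f x) \<bullet> b =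
      (LINT x|lborel. (f x *\<^sub>R gradient h x + h x *\<^sub>R gradient f x) \<bullet> b)"
      by (rule integral_inner_left[symmetric]) (use i1 i2 in auto)
    also have "\<dots> = (LINT x|lborel. dd (\<lambda>x. f x * h x) b x)"
      by (simp add: inner_add_left gradient_inner[OF b] dd_mult[OF K(1) K'(1)] mult.commute)
    also have "\<dots> = 0"
      by (rule integral_dd_eq_0[OF sm[rule_format] K(2) _ b]) (simp add: K)
    finally show "(LINT x|lborel. f x *\<^sub>R gradient h x + h x *\<^sub>R gradient f x) \<bullet> b = 0 \<bullet> b" by simp
  qed
  then show "(LINT x|lebesgue_on D. f x *\<^sub>R gradient h x) = - (LINT x|lebesgue_on D. h x *\<^sub>R gradient f x)"
    unfolding 1 2 using i1 i2 by (simp add: eq_neg_iff_add_eq_0)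
qed

lemma test_function_H1_0:
  assumes "open D" "f \<in> test_functions D"
  shows "(f, gradient f) \<in> H1_0 D"
proof -
  have "(f, gradient f) \<in> H1 D"
    using L2_norm_on_test_function[OF assms] weak_gradient_test_function[OF assms] by (simp add: H1_def)
  moreover have "H1_norm D (\<lambda>x. f x - f x) (\<lambda>x. gradient f x - gradient f x) = 0"
    by (simp add: H1_norm_def L2_norm_on_def)
  ultimately show ?thesis
    unfolding H1_0_def using assms(2) by (simp, intro exI[of _ "\<lambda>_. f"]) simp
qed

section \<open>The eigenvalue as an infimum over test functions\<close>

lemma lambda1_le:
  assumes "open D" "f \<in> test_functions D" "sqint f > 0"
  shows "\<lambda>\<^sub>1 D \<le> ennreal (dirichlet f / sqint f)"
proof -
  have "\<not> (AE x in lebesgue_on D. f x = 0)"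
  proof
    assume "AE x in lebesgue_on D. f x = 0"
    then have "AE x in lebesgue_on D. (norm (f x))\<^sup>2 = 0" by auto
    then have "(LINT x|lebesgue_on D. (norm (f x))\<^sup>2) = 0" by (rule integral_eq_zero_AE)
    then have "(L2_norm_on D f)\<^sup>2 = 0" by (simp add: L2_norm_on_def)
    then show False using L2_norm_on_test_function[OF assms(1,2)] assms(3) by simp
  qed
  then show ?thesis
    unfolding lambda1_def
    by (intro Inf_lower CollectI exI[of _ f] exI[of _ "gradient f"] conjI test_function_H1_0[OF assms(1,2)])
       (simp add: L2_norm_on_test_function[OF assms(1,2)])
qed

text \<open>Young's inequality for the cross term; \<open>t\<close> stays free so that it can be
  optimised in \<open>L2_triangle\<close>.\<close>

lemma norm_add_sq_le:
  fixes a b :: "'b::real_normed_vector"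
  assumes "t > 0"
  shows "(norm (a + b))\<^sup>2 \<le> (1 + t) * (norm a)\<^sup>2 + (1 + 1/t) * (norm b)\<^sup>2"
proof -
  have "(norm (a + b))\<^sup>2 \<le> (norm a + norm b)\<^sup>2" by (intro power_mono norm_triangle_ineq) auto
  also have "\<dots> \<le> (1 + t) * (norm a)\<^sup>2 + (1 + 1/t) * (norm b)\<^sup>2"
  proof -
    have "0 \<le> (t * norm a - norm b)\<^sup>2 / t" using assms by simp
    also have "\<dots> = t * (norm a)\<^sup>2 - 2 * norm a * norm b + (norm b)\<^sup>2 / t"
      using assms by (simp add: power2_eq_square field_simps)
    finally show ?thesis by (simp add: power2_eq_square algebra_simps)
  qed
  finally show ?thesis .
qed

lemma L2_triangle:
  fixes f g :: "'a \<Rightarrow> 'b::{banach, second_countable_topology}"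
  assumes [measurable]: "f \<in> borel_measurable M" "g \<in> borel_measurable M"
    and f: "integrable M (\<lambda>x. (norm (f x))\<^sup>2)" and g: "integrable M (\<lambda>x. (norm (g x))\<^sup>2)"
  shows "integrable M (\<lambda>x. (norm (f x + g x))\<^sup>2)"
    and "sqrt (LINT x|M. (norm (f x + g x))\<^sup>2) \<le>
      sqrt (LINT x|M. (norm (f x))\<^sup>2) + sqrt (LINT x|M. (norm (g x))\<^sup>2)"
proof -
  show int: "integrable M (\<lambda>x. (norm (f x + g x))\<^sup>2)"
  proof (rule Bochner_Integration.integrable_bound)
    show "integrable M (\<lambda>x. (1+1) * (norm (f x))\<^sup>2 + (1 + 1/1) * (norm (g x))\<^sup>2)" using f g by simp
    show "AE x in M. norm ((norm (f x + g x))\<^sup>2) \<le> norm ((1+1) * (norm (f x))\<^sup>2 + (1 + 1/1) * (norm (g x))\<^sup>2)"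
    proof (rule AE_I2)
      show "norm ((norm (f x + g x))\<^sup>2) \<le> norm ((1+1) * (norm (f x))\<^sup>2 + (1 + 1/1) * (norm (g x))\<^sup>2)" for x
        using norm_add_sq_le[of 1 "f x" "g x"] by simp
    qed
  qed measurable
  define a b where "a = sqrt (LINT x|M. (norm (f x))\<^sup>2)" and "b = sqrt (LINT x|M. (norm (g x))\<^sup>2)"
  have ab: "a \<ge> 0" "b \<ge> 0" by (auto simp: a_def b_def)
  have a2: "a\<^sup>2 = (LINT x|M. (norm (f x))\<^sup>2)" "b\<^sup>2 = (LINT x|M. (norm (g x))\<^sup>2)" by (auto simp: a_def b_def)
  have "sqrt (LINT x|M. (norm (f x + g x))\<^sup>2) \<le> a + b + e" if "e > 0" for e
  proof -
    \<comment> \<open>The summand e/2 makes both numbers positive. Then \<open>t = B / A\<close> is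
      the minimiser of \<open>(1 + t) * A^2 + (1 + 1/t) * B^2\<close>, and the minimum is
      \<open>(A + B)^2\<close>.\<close>
    define A B where "A = a + e/2" and "B = b + e/2"
    have AB: "A > 0" "B > 0" using ab that by (auto simp: A_def B_def)
    define t where "t = B / A"
    have t: "t > 0" using AB by (simp add: t_def)
    have "(LINT x|M. (norm (f x + g x))\<^sup>2) \<le> (LINT x|M. (1+t) * (norm (f x))\<^sup>2 + (1 + 1/t) * (norm (g x))\<^sup>2)"
      using f g by (intro integral_mono int norm_add_sq_le t) auto
    also have "\<dots> = (1+t) * a\<^sup>2 + (1 + 1/t) * b\<^sup>2" using f g by (simp add: a2)
    also have "\<dots> \<le> (1+t) * A\<^sup>2 + (1 + 1/t) * B\<^sup>2"
      using t ab that by (intro add_mono mult_left_mono power_mono) (auto simp: A_def B_def)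
    also have "\<dots> = (A + B)\<^sup>2" using AB by (simp add: t_def field_simps power2_eq_square)
    finally have "sqrt (LINT x|M. (norm (f x + g x))\<^sup>2) \<le> A + B" using AB by (intro real_le_lsqrt) auto
    then show ?thesis by (simp add: A_def B_def)
  qed
  then show "sqrt (LINT x|M. (norm (f x + g x))\<^sup>2) \<le>
      sqrt (LINT x|M. (norm (f x))\<^sup>2) + sqrt (LINT x|M. (norm (g x))\<^sup>2)"
    unfolding a_def b_def by (rule field_le_epsilon)
qed

lemma L2_norm_on_diff:
  fixes f g :: "'a::euclidean_space \<Rightarrow> 'b::{banach, second_countable_topology}"
  assumes "f \<in> L2_on D" "g \<in> L2_on D"
  shows "\<bar>L2_norm_on D f - L2_norm_on D g\<bar> \<le> L2_norm_on D (\<lambda>x. f x - g x)"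
proof -
  have *: "L2_norm_on D f \<le> L2_norm_on D (\<lambda>x. f x - g x) + L2_norm_on D g"
    if "f \<in> L2_on D" "g \<in> L2_on D" for f g :: "'a \<Rightarrow> 'b"
  proof -
    have m[measurable]: "f \<in> borel_measurable (lebesgue_on D)" "g \<in> borel_measurable (lebesgue_on D)"
      and i: "integrable (lebesgue_on D) (\<lambda>x. (norm (f x))\<^sup>2)" "integrable (lebesgue_on D) (\<lambda>x. (norm (g x))\<^sup>2)"
      using that by (auto simp: L2_on_def)
    have "integrable (lebesgue_on D) (\<lambda>x. (norm (f x + - g x))\<^sup>2)"
      using i by (intro L2_triangle) auto
    then show ?thesis
      using L2_triangle(2)[of "\<lambda>x. f x - g x" "lebesgue_on D" g] i m by (simp add: L2_norm_on_def)
  qed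
  have "L2_norm_on D (\<lambda>x. g x - f x) = L2_norm_on D (\<lambda>x. f x - g x)"
    by (simp add: L2_norm_on_def norm_minus_commute)
  then show ?thesis using *[OF assms] *[OF assms(2,1)] by simp
qed

text \<open>A pair in \<open>H1_0 D\<close> is a limit of test functions. By the reverse triangle
  inequality both L2 norms converge, and the limit of the denominators is positive because
  \<open>u\<close> is not zero almost everywhere. Hence all but finitely many of the approximating
  functions have positive \<open>sqint\<close>, their quotients converge, and the lower bound passes
  to the limit.\<close>

lemma le_lambda1:
  fixes D :: "'a::euclidean_space set"
  assumes "open D" and c: "\<And>f. f \<in> test_functions D \<Longrightarrow> sqint f > 0 \<Longrightarrow> c \<le> ennreal (dirichlet f / sqint f)"
  shows "c \<le> \<lambda>\<^sub>1 D"
  unfolding lambda1_def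
proof (intro Inf_greatest, clarsimp)
  fix u :: "'a \<Rightarrow> real" and g :: "'a \<Rightarrow> 'a"
  assume ug: "(u, g) \<in> H1_0 D" and nz: "\<not> (AE x in lebesgue_on D. u x = 0)"
  obtain f where f: "\<And>k. f k \<in> test_functions D"
    and lim: "(\<lambda>k. H1_norm D (\<lambda>x. f k x - u x) (\<lambda>x. gradient (f k) x - g x)) \<longlonglongrightarrow> 0"
    using ug by (auto simp: H1_0_def)
  have u: "u \<in> L2_on D" and g: "g \<in> L2_on D" using ug by (auto simp: H1_0_def H1_def)
  have "(\<lambda>k. L2_norm_on D (f k) - L2_norm_on D u) \<longlonglongrightarrow> 0"
  proof (rule Lim_null_comparison[OF _ lim], intro always_eventually allI)
    fix k show "norm (L2_norm_on D (f k) - L2_norm_on D u) \<le> H1_norm D (\<lambda>x. f k x - u x) (\<lambda>x. gradient (f k) x - g x)"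
      using L2_norm_on_diff[OF L2_norm_on_test_function(3)[OF assms(1) f] u, of k]
      unfolding H1_norm_def real_norm_def by (rule order_trans) (simp add: real_le_rsqrt)
  qed
  then have 1: "(\<lambda>k. sqint (f k)) \<longlonglongrightarrow> (L2_norm_on D u)\<^sup>2"
    using tendsto_power[of "\<lambda>k. L2_norm_on D (f k)" "L2_norm_on D u" sequentially 2]
    by (simp add: LIM_zero_iff L2_norm_on_test_function[OF assms(1) f])
  have "(\<lambda>k. L2_norm_on D (gradient (f k)) - L2_norm_on D g) \<longlonglongrightarrow> 0"
  proof (rule Lim_null_comparison[OF _ lim], intro always_eventually allI)
    fix k show "norm (L2_norm_on D (gradient (f k)) - L2_norm_on D g) \<le> H1_norm D (\<lambda>x. f k x - u x) (\<lambda>x. gradient (f k) x - g x)"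
      using L2_norm_on_diff[OF L2_norm_on_test_function(4)[OF assms(1) f] g, of k]
      unfolding H1_norm_def real_norm_def by (rule order_trans) (simp add: real_le_rsqrt)
  qed
  then have 2: "(\<lambda>k. dirichlet (f k)) \<longlonglongrightarrow> (L2_norm_on D g)\<^sup>2"
    using tendsto_power[of "\<lambda>k. L2_norm_on D (gradient (f k))" "L2_norm_on D g" sequentially 2]
    by (simp add: LIM_zero_iff L2_norm_on_test_function[OF assms(1) f])
  have "(L2_norm_on D u)\<^sup>2 \<noteq> 0"
  proof
    assume "(L2_norm_on D u)\<^sup>2 = 0"
    then have "(LINT x|lebesgue_on D. (norm (u x))\<^sup>2) = 0" by (simp add: L2_norm_on_def)
    then have "AE x in lebesgue_on D. (norm (u x))\<^sup>2 = 0"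
      using u by (subst (asm) integral_nonneg_eq_0_iff_AE) (auto simp: L2_on_def)
    then show False using nz by simp
  qed
  then have pos: "(L2_norm_on D u)\<^sup>2 > 0" by simp
  have "(\<lambda>k. ennreal (dirichlet (f k) / sqint (f k))) \<longlonglongrightarrow> ennreal ((L2_norm_on D g)\<^sup>2 / (L2_norm_on D u)\<^sup>2)"
    using pos by (intro tendsto_ennrealI tendsto_divide 1 2) auto
  moreover have "\<forall>\<^sub>F k in sequentially. c \<le> ennreal (dirichlet (f k) / sqint (f k))"
    using order_tendstoD(1)[OF 1 pos] by eventually_elim (use c f in auto)
  ultimately show "c \<le> ennreal ((L2_norm_on D g)\<^sup>2 / (L2_norm_on D u)\<^sup>2)"
    by (intro tendsto_lowerbound) auto
qed

text \<open>A Poincare inequality. The b-derivative of \<open>(x \<bullet> b) * f^2\<close> has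
  integral zero and \<open>x \<bullet> b\<close> is at most 1 in absolute value on the support, so
  Young's inequality bounds the integral of \<open>f^2\<close> by half of itself plus twice the
  Dirichlet integral; this gives 1/4. Positivity is what decides the case of inradius 0 in the
  theorem.\<close>

lemma lambda1_ball_pos: "\<lambda>\<^sub>1 (ball (0::'a::euclidean_space) 1) > 0"
proof -
  have "ennreal (1/4) \<le> \<lambda>\<^sub>1 (ball (0::'a) 1)"
  proof (rule le_lambda1)
    fix f :: "'a \<Rightarrow> real" assume f: "f \<in> test_functions (ball 0 1)" and pos: "sqint f > 0"
    obtain K where K: "smooth f" "compact K" "K \<subseteq> ball 0 1" "\<And>x. x \<notin> K \<Longrightarrow> f x = 0"
      using f by (elim test_functionsE) auto
    obtain b :: 'a where b: "b \<in> Basis" using nonempty_Basis by blast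
    have sm2: "smooth (\<lambda>x. f x * f x)" using K(1) C_k_mult by blast
    then have sm: "smooth (\<lambda>x. (x \<bullet> b) * (f x * f x))" using C_k_mult C_k_inner by blast
    have i1: "integrable lborel (\<lambda>x. (f x)\<^sup>2)" "integrable lborel (\<lambda>x. (norm (gradient f x))\<^sup>2)"
      using test_function_integrable[OF f] by auto
    have i2: "integrable lborel (\<lambda>x. 2 * ((x \<bullet> b) * (f x * dd f b x)))"
      by (rule integrable_compact_support[OF _ K(2)])
         (intro continuous_on_mult continuous_on_inner continuous_on_const continuous_on_id
            smooth_continuous smooth_dd K(1) b, simp add: K)
    have "dd (\<lambda>x. (x \<bullet> b) * (f x * f x)) b x = (f x)\<^sup>2 + 2 * ((x \<bullet> b) * (f x * dd f b x))" for x
      unfolding dd_mult[OF allI[OF C_k_inner] sm2] dd_mult[OF K(1) K(1)] using b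
      by (simp add: algebra_simps power2_eq_square)
    moreover have "(LINT x|lborel. dd (\<lambda>x. (x \<bullet> b) * (f x * f x)) b x) = 0"
      by (rule integral_dd_eq_0[OF sm[rule_format] K(2) _ b]) (simp add: K)
    ultimately have "sqint f = - (LINT x|lborel. 2 * ((x \<bullet> b) * (f x * dd f b x)))"
      using Bochner_Integration.integral_add[OF i1(1) i2] by (simp add: sqint_def)
    also have "\<dots> = (LINT x|lborel. - (2 * ((x \<bullet> b) * (f x * dd f b x))))" by simp
    also have "\<dots> \<le> (LINT x|lborel. 1/2 * (f x)\<^sup>2 + 2 * (norm (gradient f x))\<^sup>2)"
    proof (rule integral_mono)
      show "integrable lborel (\<lambda>x. - (2 * ((x \<bullet> b) * (f x * dd f b x))))" using i2 by (rule integrable_minus)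
      show "integrable lborel (\<lambda>x. 1/2 * (f x)\<^sup>2 + 2 * (norm (gradient f x))\<^sup>2)" using i1 by auto
      fix x :: 'a
      have d: "(dd f b x)\<^sup>2 \<le> (norm (gradient f x))\<^sup>2"
        unfolding norm_gradient_sq by (rule member_le_sum) (use b in auto)
      show "- (2 * ((x \<bullet> b) * (f x * dd f b x))) \<le> 1/2 * (f x)\<^sup>2 + 2 * (norm (gradient f x))\<^sup>2"
      proof (cases "x \<in> K")
        case True
        then have "norm x < 1" using K(3) by auto
        then have xb: "\<bar>x \<bullet> b\<bar> \<le> 1" using Basis_le_norm[OF b, of x] by simp
        have "- (2 * ((x \<bullet> b) * (f x * dd f b x))) \<le> 2 * (\<bar>x \<bullet> b\<bar> * (\<bar>f x * dd f b x\<bar>))"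
        proof -
          have "- (p * q) \<le> \<bar>p\<bar> * \<bar>q\<bar>" for p q :: real by (metis abs_ge_minus_self abs_mult)
          from this[of "x \<bullet> b" "f x * dd f b x"] show ?thesis by linarith
        qed
        also have "\<dots> \<le> 2 * (1 * \<bar>f x * dd f b x\<bar>)"
          using xb by (intro mult_left_mono mult_right_mono) auto
        also have "\<dots> \<le> 1/2 * (f x)\<^sup>2 + 2 * (dd f b x)\<^sup>2"
        proof -
          have "2 * (1 * \<bar>p * q\<bar>) \<le> 1/2 * p\<^sup>2 + 2 * q\<^sup>2" for p q :: real
          proof -
            have "0 \<le> (\<bar>p\<bar> - 2 * \<bar>q\<bar>)\<^sup>2" by simp
            then have "0 \<le> p\<^sup>2 - 4 * (\<bar>p\<bar> * \<bar>q\<bar>) + 4 * q\<^sup>2"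
              by (simp add: power2_eq_square algebra_simps)
            then show ?thesis unfolding abs_mult by linarith
          qed
          then show ?thesis by blast
        qed
        finally show ?thesis using d by simp
      qed (simp add: K)
    qed
    also have "\<dots> = 1/2 * sqint f + 2 * dirichlet f"
      using i1 by (simp add: sqint_def dirichlet_def)
    finally have "1/4 \<le> dirichlet f / sqint f" using pos by (simp add: field_simps)
    then show "ennreal (1/4) \<le> ennreal (dirichlet f / sqint f)" by (rule ennreal_leI)
  qed simp
  then show ?thesis by (rule less_le_trans[rotated]) simp
qed

section \<open>The regularised Newtonian kernel\<close>

text \<open>The Newtonian kernel with \<open>|x|^2\<close> replaced by \<open>|x|^2 + d^2\<close>.
  For d > 0 it is smooth and bounded, remains superharmonic, and does not exceed the Newtonian
  kernel.\<close>

definition kern :: "real \<Rightarrow> 'a::euclidean_space \<Rightarrow> real"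
  where "kern d x = ((norm x)\<^sup>2 + d\<^sup>2) powr (- (real (DIM('a) - 2) / 2))"

lemma base_pos: "d > 0 \<Longrightarrow> (norm x)\<^sup>2 + d\<^sup>2 > (0::real)"
  by (intro add_nonneg_pos) auto

lemma smooth_base: "smooth (\<lambda>x::'a::euclidean_space. (norm (x - a))\<^sup>2 + d\<^sup>2)"
proof -
  have "(norm (x - a))\<^sup>2 + d\<^sup>2 = (\<Sum>b\<in>Basis. (x \<bullet> b + - (a \<bullet> b)) * (x \<bullet> b + - (a \<bullet> b))) + d\<^sup>2" for x
    unfolding power2_norm_eq_inner euclidean_inner[of "x - a" "x - a"] by (simp add: inner_diff_left)
  then show ?thesis by (simp only:) (intro allI C_k_add C_k_sum C_k_mult C_k_inner C_k_const)
qed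

lemma smooth_powr_base:
  assumes "d > 0" shows "smooth (\<lambda>x::'a::euclidean_space. ((norm (x - a))\<^sup>2 + d\<^sup>2) powr s)"
proof
  fix k
  \<comment> \<open>Multiples of real powers are closed under differentiation on t > 0, and the base
    takes its values there because d > 0.\<close>
  define G where "G = range (\<lambda>p t::real. fst p * t powr snd p)"
  have "\<exists>g'\<in>G. \<forall>t\<in>{0<..}. (g has_real_derivative g' t) (at t)" if gG: "g \<in> G" for g
  proof -
    obtain p where p: "g = (\<lambda>t. fst p * t powr snd p)" using gG unfolding G_def by blast
    define c s where "c = fst p" and "s = snd p"
    have g: "g = (\<lambda>t. c * t powr s)" by (simp add: p c_def s_def)
    have "(g has_real_derivative (c * s) * t powr (s - 1)) (at t)" if "t > 0" for t
      unfolding g using that by (auto intro!: derivative_eq_intros has_real_derivative_powr)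
    moreover have "(\<lambda>t. (c * s) * t powr (s - 1)) \<in> G"
      unfolding G_def by (rule range_eqI[of _ _ "(c * s, s - 1)"]) simp
    ultimately show ?thesis by (intro bexI[of _ "\<lambda>t. (c * s) * t powr (s - 1)"]) auto
  qed
  moreover have "(\<lambda>t. 1 * t powr s) \<in> G" unfolding G_def by (rule range_eqI[of _ _ "(1, s)"]) simp
  ultimately have "C_k k (\<lambda>x::'a. 1 * ((norm (x - a))\<^sup>2 + d\<^sup>2) powr s)"
    by (intro C_k_compose[of "\<lambda>t. 1 * t powr s" G _ "{0<..}"] smooth_base) (auto simp: base_pos[OF assms])
  then show "C_k k (\<lambda>x::'a. ((norm (x - a))\<^sup>2 + d\<^sup>2) powr s)" by simp
qed

lemma smooth_kern: "d > 0 \<Longrightarrow> smooth (\<lambda>x. kern d (x - a))"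
  unfolding kern_def by (rule smooth_powr_base)

lemma dd_powr_base:
  fixes a b x :: "'a::euclidean_space"
  assumes "d > 0"
  shows "dd (\<lambda>x. ((norm (x - a))\<^sup>2 + d\<^sup>2) powr s) b x = 
    2 * s * ((norm (x - a))\<^sup>2 + d\<^sup>2) powr (s - 1) * ((x - a) \<bullet> b)"
proof -
  have "((\<lambda>t. t powr s) has_real_derivative s * ((norm (x - a))\<^sup>2 + d\<^sup>2) powr (s - 1)) (at ((norm (x - a))\<^sup>2 + d\<^sup>2))"
    using base_pos[OF assms] by (rule has_real_derivative_powr)
  from dd_compose[of _ _ "\<lambda>x. (norm (x - a))\<^sup>2 + d\<^sup>2", OF this smooth_base]
  have "dd (\<lambda>x. ((norm (x - a))\<^sup>2 + d\<^sup>2) powr s) b x =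
    s * ((norm (x - a))\<^sup>2 + d\<^sup>2) powr (s - 1) * dd (\<lambda>x. (norm (x - a))\<^sup>2 + d\<^sup>2) b x" .
  moreover have "dd (\<lambda>x. (norm (x - a))\<^sup>2 + d\<^sup>2) b x = 2 * ((x - a) \<bullet> b)"
    unfolding power2_norm_eq_inner
    by (rule dd_eq) (auto intro!: derivative_eq_intros simp: inner_commute)
  ultimately show ?thesis by simp
qed

text \<open>With n the dimension, \<open>q = |x - a|^2 + d^2\<close> and
  \<open>s = (2 - n) / 2\<close>, the Laplacian of \<open>q powr s\<close> is \<open>4 s (s - 1) q
  powr (s - 2) * |x - a|^2 + 2 n s q powr (s - 1)\<close>. Because \<open>n = - 2 (s - 1)\<close>,
  everything cancels except \<open>- 4 s (s - 1) d^2 q powr (s - 2)\<close>, and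
  \<open>s (s - 1)\<close> is nonnegative.\<close>

lemma lap_kern_nonpos:
  fixes a x :: "'a::euclidean_space"
  assumes "d > 0" "DIM('a) \<ge> 2"
  shows "lap (\<lambda>x. kern d (x - a)) x \<le> 0"
proof -
  define s where "s = - (real (DIM('a) - 2) / 2)"
  define q where "q x = (norm (x - a))\<^sup>2 + d\<^sup>2" for x
  have q: "q x > 0" using base_pos[OF assms(1)] by (simp add: q_def)
  have s: "real (DIM('a)) = - 2 * (s - 1)" "s \<le> 0"
    using assms(2) by (auto simp: s_def of_nat_diff field_simps)
  have k: "(\<lambda>x. kern d (x - a)) = (\<lambda>x. q x powr s)" by (simp add: kern_def q_def s_def)
  have "dd (dd (\<lambda>x. kern d (x - a)) b) b x =
      4 * s * (s - 1) * q x powr (s - 2) * ((x - a) \<bullet> b)\<^sup>2 + 2 * s * q x powr (s - 1)"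
    if b: "b \<in> Basis" for b
  proof -
    have 1: "dd (\<lambda>x. kern d (x - a)) b = (\<lambda>x. q x powr (s - 1) * (2 * s * (x \<bullet> b + - (a \<bullet> b))))"
      unfolding k q_def dd_powr_base[OF assms(1)] by (auto simp: inner_diff_left)
    have sm: "smooth (\<lambda>x. 2 * s * (x \<bullet> b + - (a \<bullet> b)))"
      by (intro allI C_k_mult C_k_add C_k_const C_k_inner)
    have "((\<lambda>x. 2 * s * (x \<bullet> b + - (a \<bullet> b))) has_derivative (\<lambda>h. 2 * s * (h \<bullet> b))) (at x)"
      by (auto intro!: derivative_eq_intros)
    then have "dd (\<lambda>x. 2 * s * (x \<bullet> b + - (a \<bullet> b))) b x = 2 * s"
      using b by (simp add: dd_eq)
    then show ?thesis
      unfolding 1 q_def dd_mult[OF smooth_powr_base[OF assms(1)] sm] dd_powr_base[OF assms(1)]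
      by (simp add: inner_diff_left power2_eq_square algebra_simps)
  qed
  then have "lap (\<lambda>x. kern d (x - a)) x =
      4 * s * (s - 1) * q x powr (s - 2) * (norm (x - a))\<^sup>2 + DIM('a) * (2 * s * q x powr (s - 1))"
    unfolding lap_def power2_norm_eq_inner euclidean_inner[of "x - a" "x - a"]
    by (simp add: sum.distrib sum_distrib_left power2_eq_square)
  also have "q x powr (s - 1) = q x powr (s - 2) * q x"
    using powr_mult_base[of "q x" "s - 2"] q by (simp add: mult.commute)
  also have "4 * s * (s - 1) * q x powr (s - 2) * (norm (x - a))\<^sup>2 + DIM('a) * (2 * s * (q x powr (s - 2) * q x))
     = - (4 * (s * (s - 1)) * q x powr (s - 2) * d\<^sup>2)"
    unfolding s(1) q_def by (simp add: algebra_simps)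
  also have "\<dots> \<le> 0"
    using s(2) q by (simp add: mult_nonpos_nonpos)
  finally show ?thesis .
qed

section \<open>A bound, uniform in \<open>d\<close> and the pole, for the integral of the kernel
  over the unit ball\<close>

lemma kern_nonneg [simp]: "0 \<le> kern d x"
  by (simp add: kern_def)

lemma kern_minus [simp]: "kern d (- x) = kern d x"
  by (simp add: kern_def)

lemma lborel_integral_affine:
  fixes f :: "'a::euclidean_space \<Rightarrow> 'b::{banach, second_countable_topology}"
  assumes [measurable]: "f \<in> borel_measurable borel" and c: "c \<noteq> 0"
  shows "(LINT x|lborel. f x) = \<bar>c\<bar> ^ DIM('a) *\<^sub>R (LINT x|lborel. f (t + c *\<^sub>R x))"
  by (subst lborel_affine[OF c, of t]) (simp add: integral_density integral_distr)

lemma integrable_kern_ball: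
  assumes "d > 0"
  shows "integrable lborel (\<lambda>x. indicator (ball (c::'a::euclidean_space) r) x * kern d (x - a))"
proof (rule Bochner_Integration.integrable_bound)
  have cont: "continuous_on UNIV (\<lambda>x. kern d (x - a))"
    using smooth_continuous[OF smooth_kern[OF assms]] .
  then show "integrable lborel (\<lambda>x. indicator (cball c r) x *\<^sub>R kern d (x - a))"
    by (intro borel_integrable_compact) (auto intro: continuous_on_subset)
  have [measurable]: "(\<lambda>x. kern d (x - a)) \<in> borel_measurable borel"
    using cont by (rule borel_measurable_continuous_onI)
  show "(\<lambda>x. indicator (ball c r) x * kern d (x - a)) \<in> borel_measurable lborel"
    by (intro borel_measurable_times borel_measurable_indicator) auto
qed (auto simp: indicator_def)

text \<open>Substituting \<open>x / 2\<close> for \<open>x\<close> shows that the integral over the unit ball is at most a quarter of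
  that over the ball of radius 2, because the kernel decreases in \<open>d\<close>; so both are controlled by the
  part outside the unit ball.\<close>

lemma integral_kern_ball_le:
  fixes a :: "'a::euclidean_space"
  assumes d: "d > 0" and n: "DIM('a) \<ge> 2" and a: "a \<in> ball 0 1"
  shows "(LINT x|lborel. indicator (ball 0 1) x * kern d (x - a)) \<le> 4/3 * measure lborel (ball (0::'a) 2)"
proof -
  define J where "J r = (LINT x|lborel. indicator (ball (0::'a) r) x * kern d x)" for r
  have cont: "continuous_on UNIV (\<lambda>x::'a. kern d (x - a))" for a
    using smooth_continuous[OF smooth_kern[OF d]] .
  have [measurable]: "kern d \<in> borel_measurable (borel :: 'a measure)"
    using borel_measurable_continuous_onI[OF cont[of 0]] by simp
  have int: "integrable lborel (\<lambda>x. indicator (ball c r) x * kern d x)" for c :: 'a and r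
    using integrable_kern_ball[OF d, of c r 0] by simp
  have int2: "integrable lborel (indicator (ball (0::'a) 2) :: 'a \<Rightarrow> real)"
    using emeasure_lborel_ball_finite[of "0::'a" 2] by simp
  \<comment> \<open>Halving x amounts to the factor 1/4 in the base together with
    \<open>4 d^2\<close> instead of \<open>d^2\<close>; the latter only lowers the kernel. The
    factor obtained here, against \<open>(1/2)^n\<close> from the substitution, leaves the
    quarter.\<close>
  have half: "kern d ((1/2) *\<^sub>R x) \<le> 2 ^ (DIM('a) - 2) * kern d x" for x :: 'a
  proof -
    define m where "m = real (DIM('a) - 2) / 2"
    have "kern d ((1/2) *\<^sub>R x) = (1/4 * ((norm x)\<^sup>2 + 4 * d\<^sup>2)) powr (- m)"
      by (simp add: kern_def m_def power_mult_distrib field_simps)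
    also have "\<dots> = (1/4) powr (- m) * ((norm x)\<^sup>2 + 4 * d\<^sup>2) powr (- m)"
      using powr_mult by blast
    also have "(1/4::real) powr (- m) = 2 ^ (DIM('a) - 2)"
    proof -
      have "(1/4::real) = 2 powr (- 2)" by (simp add: powr_minus powr_numeral)
      then have "(1/4::real) powr (- m) = 2 powr (real (DIM('a) - 2))"
        by (simp only: powr_powr) (simp add: m_def)
      then show ?thesis by (simp add: powr_realpow)
    qed
    also have "((norm x)\<^sup>2 + 4 * d\<^sup>2) powr (- m) \<le> kern d x"
      unfolding kern_def m_def[symmetric] using base_pos[OF d, of x] by (intro powr_mono2') (auto simp: m_def)
    finally show ?thesis by simp
  qed
  have "J 1 = \<bar>1/2\<bar> ^ DIM('a) *\<^sub>R (LINT x|lborel. indicator (ball 0 1) (0 + (1/2) *\<^sub>R x) * kern d (0 + (1/2) *\<^sub>R (x::'a)))"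
    unfolding J_def by (rule lborel_integral_affine) (auto intro!: borel_measurable_times borel_measurable_indicator)
  also have "\<dots> = (1/2) ^ DIM('a) * (LINT x|lborel. indicator (ball 0 2) x * kern d ((1/2) *\<^sub>R (x::'a)))"
  proof -
    have "indicator (ball 0 1) ((1/2) *\<^sub>R x) = (indicator (ball 0 2) x :: real)" for x :: 'a
      by (auto simp: indicator_def)
    then show ?thesis by simp
  qed
  also have "\<dots> \<le> (1/2) ^ DIM('a) * (LINT x|lborel. 2 ^ (DIM('a) - 2) * (indicator (ball 0 2) x * kern d (x::'a)))"
  proof (rule mult_left_mono[OF integral_mono])
    have "continuous_on UNIV (\<lambda>x::'a. kern d ((1/2) *\<^sub>R x))"
    proof -
      have "continuous_on UNIV (\<lambda>x::'a. kern d ((1/2) *\<^sub>R x - 0))"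
        by (rule continuous_on_compose2[OF cont[of 0]]) (auto intro!: continuous_intros)
      then show ?thesis by simp
    qed
    then have "integrable lborel (\<lambda>x::'a. indicator (cball 0 2) x *\<^sub>R kern d ((1/2) *\<^sub>R x))"
      by (intro borel_integrable_compact) (auto intro: continuous_on_subset)
    then show "integrable lborel (\<lambda>x::'a. indicator (ball 0 2) x * kern d ((1/2) *\<^sub>R x))"
      by (rule Bochner_Integration.integrable_bound) (auto simp: indicator_def)
    show "integrable lborel (\<lambda>x::'a. 2 ^ (DIM('a) - 2) * (indicator (ball 0 2) x * kern d x))"
      using int by (rule integrable_mult_right)
    show "indicator (ball 0 2) x * kern d ((1/2) *\<^sub>R x) \<le> 2 ^ (DIM('a) - 2) * (indicator (ball 0 2) x * kern d x)"
      for x :: 'a using half[of x] by (auto simp: indicator_def)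
  qed simp
  also have "\<dots> = 1/4 * J 2"
  proof -
    have "(1/2::real) ^ DIM('a) * 2 ^ (DIM('a) - 2) = 1/4"
    proof -
      have "DIM('a) = (DIM('a) - 2) + 2" using n by simp
      then have "(1/2::real) ^ DIM('a) = (1/2) ^ (DIM('a) - 2) * (1/2)\<^sup>2" by (metis power_add)
      then show ?thesis by (simp add: power_divide power2_eq_square)
    qed
    then show ?thesis
      unfolding J_def integral_mult_right_zero by (simp only: mult.assoc[symmetric])
  qed
  finally have 1: "J 1 \<le> 1/4 * J 2" .
  \<comment> \<open>Outside the unit ball the kernel is at most 1. Combined with
    \<open>J 1 \<le> 1/4 * J 2\<close> this leaves three quarters of \<open>J 2\<close> below the
    volume, whence the constant 4/3.\<close>
  have "J 2 \<le> (LINT x|lborel. indicator (ball (0::'a) 1) x * kern d x + indicator (ball 0 2) x)"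
    unfolding J_def
  proof (intro integral_mono)
    show "integrable lborel (\<lambda>x::'a. indicator (ball 0 1) x * kern d x + indicator (ball 0 2) x)"
      using int int2 by (rule Bochner_Integration.integrable_add)
    fix x :: 'a
    have "kern d x \<le> 1" if "norm x \<ge> 1"
    proof -
      have "(norm x)\<^sup>2 + d\<^sup>2 \<ge> 1" using that by (smt (verit) one_le_power zero_le_power2)
      then have "kern d x \<le> 1 powr (- (real (DIM('a) - 2) / 2))"
        unfolding kern_def by (intro powr_mono2') auto
      then show ?thesis by simp
    qed
    then show "indicator (ball 0 2) x * kern d x \<le> indicator (ball 0 1) x * kern d x + indicator (ball 0 2) x"
      by (auto simp: indicator_def)
  qed (rule int)
  also have "\<dots> = J 1 + measure lborel (ball (0::'a) 2)"
    unfolding J_def using int int2 by simp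
  finally have 2: "J 2 \<le> 4/3 * measure lborel (ball (0::'a) 2)" using 1 by simp
  \<comment> \<open>Moving the pole to the origin turns the unit ball into
    \<open>ball (- a) 1\<close>, which lies in the ball of radius 2 for every admissible
    \<open>a\<close>; so the bound is uniform in \<open>a\<close>.\<close>
  have "(LINT x|lborel. indicator (ball 0 1) x * kern d (x - a)) =
      \<bar>1\<bar> ^ DIM('a) *\<^sub>R (LINT x|lborel. indicator (ball 0 1) (a + 1 *\<^sub>R x) * kern d (a + 1 *\<^sub>R x - a))"
    by (rule lborel_integral_affine)
       (auto intro!: borel_measurable_times borel_measurable_indicator borel_measurable_continuous_onI[OF cont])
  also have "\<dots> = (LINT x|lborel. indicator (ball (- a) 1) x * kern d x)"
  proof -
    have "indicator (ball 0 1) (a + x) = (indicator (ball (- a) 1) x :: real)" for x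
      by (auto simp: indicator_def dist_norm norm_minus_commute add.commute)
    then show ?thesis by simp
  qed
  also have "\<dots> \<le> J 2"
    unfolding J_def
  proof (intro integral_mono int)
    fix x
    have "x \<in> ball 0 2" if "x \<in> ball (- a) 1"
    proof -
      have "norm (- a - x) < 1" "norm a < 1" using that a by (auto simp: dist_norm)
      then have "norm x < 2" using norm_triangle_ineq4[of "- a" "- a - x"] by simp
      then show ?thesis by simp
    qed
    then show "indicator (ball (- a) 1) x * kern d x \<le> indicator (ball 0 2) x * kern d x"
      by (auto simp: indicator_def)
  qed
  finally show ?thesis using 2 by simp
qed

section \<open>Capacity through finitely supported measures\<close>

text \<open>Stands for the measure with mass \<open>w a\<close> at each \<open>a\<close> in
  \<open>S\<close>. Potentials of such measures are finite sums, so smoothness, Laplacians and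
  integrals can be treated termwise.\<close>

definition fin_prob :: "'a set \<Rightarrow> 'a set \<Rightarrow> ('a \<Rightarrow> real) \<Rightarrow> bool"
  where "fin_prob F S w \<longleftrightarrow> finite S \<and> S \<subseteq> F \<and> (\<forall>a\<in>S. 0 \<le> w a) \<and> sum w S = 1"

text \<open>The diagonal terms are included; they are finite because the regularised kernel is
  finite at 0.\<close>

definition fin_energy :: "real \<Rightarrow> 'a::euclidean_space set \<Rightarrow> ('a \<Rightarrow> real) \<Rightarrow> real"
  where "fin_energy d S w = (\<Sum>a\<in>S. w a * (\<Sum>b\<in>S. w b * kern d (a - b)))"

text \<open>The mixture of the given measure with a point mass at \<open>p\<close>, described by its
  action on functions so that the new weights stay hidden. The point \<open>p\<close> may already
  carry mass, hence the two conditional summands in \<open>w'\<close>.\<close>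

lemma fin_prob_mix:
  assumes "fin_prob F S w" "p \<in> F" "0 \<le> t" "t \<le> (1::real)"
  obtains S' w' where "fin_prob F S' w'"
    "\<And>f. (\<Sum>a\<in>S'. w' a * f a) = (1 - t) * (\<Sum>a\<in>S. w a * f a) + t * (f p :: real)"
proof
  define w' where "w' a = (1 - t) * (if a \<in> S then w a else 0) + t * (if a = p then 1 else 0)" for a
  have S: "finite S" "S \<subseteq> F" "\<And>a. a \<in> S \<Longrightarrow> 0 \<le> w a" "sum w S = 1" using assms(1) by (auto simp: fin_prob_def)
  show sum: "(\<Sum>a\<in>insert p S. w' a * f a) = (1 - t) * (\<Sum>a\<in>S. w a * f a) + t * (f p :: real)" for f
  proof -
    have "(\<Sum>a\<in>insert p S. w' a * f a) = (1 - t) * (\<Sum>a\<in>insert p S. if a \<in> S then w a * f a else 0)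
        + t * (\<Sum>a\<in>insert p S. if a = p then f a else 0)"
      unfolding sum_distrib_left sum.distrib[symmetric]
      by (rule sum.cong) (auto simp: w'_def algebra_simps)
    also have "(\<Sum>a\<in>insert p S. if a \<in> S then w a * f a else 0) = (\<Sum>a\<in>S. w a * f a)"
      using S(1) by (subst sum.inter_restrict[symmetric]) (auto intro: sum.cong)
    also have "(\<Sum>a\<in>insert p S. if a = p then f a else 0) = f p"
      using S(1) by (simp add: sum.delta')
    finally show ?thesis .
  qed
  have "sum w' (insert p S) = 1" using sum[of "\<lambda>_. 1"] S(4) by simp
  then show "fin_prob F (insert p S) w'"
    using S assms by (auto simp: fin_prob_def w'_def)
qed

text \<open>For a near-minimiser of the energy, moving the fraction \<open>t\<close> of the mass to a point \<open>p\<close> hardly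
  decreases the energy, so the potential at \<open>p\<close> cannot be much smaller than the energy.\<close>

lemma exists_large_potential:
  fixes F :: "'a::euclidean_space set"
  assumes "F \<noteq> {}" "M > 0" and M: "\<And>S w. fin_prob F S w \<Longrightarrow> M \<le> fin_energy d S w"
  shows "\<exists>S w. fin_prob F S w \<and> (\<forall>p\<in>F. M / 2 \<le> (\<Sum>a\<in>S. w a * kern d (p - a)))"
proof -
  define E where "E = {fin_energy d S w | S w. fin_prob F S w}"
  define I where "I = Inf E"
  obtain p0 where "p0 \<in> F" using assms(1) by blast
  then have "fin_prob F {p0} (\<lambda>_. 1)" by (simp add: fin_prob_def)
  then have ne: "E \<noteq> {}" by (auto simp: E_def)
  have bdd: "bdd_below E" by (rule bdd_belowI[of _ M]) (auto simp: E_def M)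
  have IM: "M \<le> I" unfolding I_def using ne by (rule cInf_greatest) (auto simp: E_def M)
  define k0 where "k0 = kern d (0::'a)"
  have k0: "k0 \<ge> 0" by (simp add: k0_def)
  \<comment> \<open>Comparing \<open>I\<close> with the energy of the mixture and dividing by t
    leaves \<open>2 * I \<le> t * (I + 1 + k0) + 2 * U p\<close>. This t makes the first summand
    equal to \<open>I\<close>, so that \<open>U p\<close> is at least \<open>I / 2\<close>. The 1
    pays for the slack \<open>t^2\<close> in near-minimality, which has the same order as the
    self-energy \<open>t^2 * k0\<close> and therefore survives the division.\<close>
  define t where "t = I / (I + 1 + k0)"
  have t: "0 < t" "t < 1" using IM assms(2) k0 by (auto simp: t_def field_simps)
  have "I < I + t\<^sup>2" using t by simp
  then obtain S w where Sw: "fin_prob F S w" "fin_energy d S w < I + t\<^sup>2"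
    using cInf_lessD[OF ne, of "I + t\<^sup>2"] unfolding I_def[symmetric] by (auto simp: E_def)
  define U where "U p = (\<Sum>a\<in>S. w a * kern d (p - a))" for p
  have "M / 2 \<le> U p" if p: "p \<in> F" for p
  proof -
    obtain S' w' where S': "fin_prob F S' w'"
      and mix: "\<And>f. (\<Sum>a\<in>S'. w' a * f a) = (1 - t) * (\<Sum>a\<in>S. w a * f a) + t * f p"
      using fin_prob_mix[OF Sw(1) p, of t] t by auto
    have Upa: "(\<Sum>a\<in>S. w a * kern d (a - p)) = U p"
      unfolding U_def by (intro sum.cong refl arg_cong2[where f=times]) (metis kern_minus minus_diff_eq)
    have "fin_energy d S' w' = (1 - t) * (\<Sum>a\<in>S. w a * ((1 - t) * U a + t * kern d (a - p)))
        + t * ((1 - t) * U p + t * k0)"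
      unfolding fin_energy_def mix U_def k0_def by simp
    also have "(\<Sum>a\<in>S. w a * ((1 - t) * U a + t * kern d (a - p))) = (1 - t) * fin_energy d S w + t * U p"
      unfolding Upa[symmetric] fin_energy_def U_def[symmetric] sum_distrib_left sum.distrib[symmetric]
      by (intro sum.cong refl) (simp add: algebra_simps)
    finally have e: "fin_energy d S' w' = (1 - t)\<^sup>2 * fin_energy d S w + 2 * t * ((1 - t) * U p) + t\<^sup>2 * k0"
      by (simp add: power2_eq_square algebra_simps)
    have "I \<le> fin_energy d S' w'" unfolding I_def by (rule cInf_lower[OF _ bdd]) (use S' in \<open>auto simp: E_def\<close>)
    also have "\<dots> \<le> (1 - t)\<^sup>2 * (I + t\<^sup>2) + 2 * t * ((1 - t) * U p) + t\<^sup>2 * k0"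
      unfolding e using Sw(2) by (intro add_right_mono mult_left_mono) auto
    also have "\<dots> \<le> (1 - t)\<^sup>2 * I + t\<^sup>2 + 2 * t * U p + t\<^sup>2 * k0"
    proof -
      have "U p \<ge> 0" unfolding U_def using Sw(1) by (intro sum_nonneg mult_nonneg_nonneg) (auto simp: fin_prob_def)
      then have "(1 - t) * U p \<le> 1 * U p" using t by (intro mult_right_mono) auto
      then have "2 * t * ((1 - t) * U p) \<le> 2 * t * (1 * U p)" using t by (intro mult_left_mono) auto
      moreover have "(1 - t)\<^sup>2 * t\<^sup>2 \<le> 1 * t\<^sup>2"
        using t by (intro mult_right_mono) (auto simp: power_le_one)
      ultimately show ?thesis by (simp add: algebra_simps)
    qed
    finally have "t * (2 * I) \<le> t * (t * (I + 1 + k0) + 2 * U p)"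
      by (simp add: power2_eq_square algebra_simps)
    then have "2 * I \<le> t * (I + 1 + k0) + 2 * U p" using t(1) by simp
    also have "t * (I + 1 + k0) = I" using IM assms(2) k0 by (simp add: t_def)
    finally show ?thesis using IM by simp
  qed
  then show ?thesis using Sw(1) unfolding U_def by blast
qed

text \<open>Indicators of a countable base of the topology encode the points of \<open>F\<close> by reals; on a compact
  set, finitely many digits of the code determine the point up to a given error.\<close>

lemma exists_real_code:
  fixes F :: "'a::euclidean_space set"
  assumes "compact F"
  obtains e :: "'a \<Rightarrow> real" where "\<And>x. 0 \<le> e x \<and> e x \<le> 2"
    "\<And>r. r > 0 \<Longrightarrow> \<exists>s>0. \<forall>p\<in>F. \<forall>q\<in>F. \<bar>e p - e q\<bar> < s \<longrightarrow> dist p q < r"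
proof -
  obtain B :: "'a set set" where B: "countable B" "topological_basis B"
    using ex_countable_basis by blast
  have "B \<noteq> {}"
    using topological_basisE[OF B(2), of UNIV undefined] by auto
  then obtain A :: "nat \<Rightarrow> 'a set" where A: "range A = B" using B(1) by (metis range_from_nat_into)
  \<comment> \<open>With ratio 1/3 all digits after the k-th add up to at most half of the k-th
    digit, so the first differing digit cannot be compensated. Ratio 1/2 would leave no gap.\<close>
  define dg where "dg k x = indicator (A k) x * (1/3::real)^k" for k and x :: 'a
  have geo: "(\<lambda>k. (1/3::real)^k) sums (3/2)" using geometric_sums[of "1/3::real"] by simp
  have sm: "summable (\<lambda>k. dg k x)" for x
    by (rule summable_comparison_test'[OF sums_summable[OF geo], of 0]) (auto simp: dg_def indicator_def)
  define e where "e x = (\<Sum>k. dg k x)" for x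
  have e02: "0 \<le> e x \<and> e x \<le> 2" for x
  proof
    show "0 \<le> e x" unfolding e_def by (intro suminf_nonneg sm) (simp add: dg_def)
    have "e x \<le> (\<Sum>k. (1/3::real)^k)" unfolding e_def
      by (intro suminf_le sm sums_summable[OF geo]) (simp add: dg_def indicator_def)
    also have "\<dots> = 3/2" using geo by (rule sums_unique[symmetric])
    finally show "e x \<le> 2" by simp
  qed
  have differ: "(1/3)^k / 2 \<le> \<bar>e p - e q\<bar>"
    if k: "(p \<in> A k) \<noteq> (q \<in> A k)" and lt: "\<And>j. j < k \<Longrightarrow> (p \<in> A j) = (q \<in> A j)" for p q k
  proof -
    define h where "h j = dg j p - dg j q" for j
    have sh: "summable h" unfolding h_def by (intro summable_diff sm)
    have "e p - e q = suminf h" unfolding e_def h_def by (rule suminf_diff[OF sm sm])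
    also have "\<dots> = (\<Sum>j. h (j + Suc k)) + sum h {..<Suc k}"
      by (rule suminf_split_initial_segment[OF sh])
    also have "sum h {..<Suc k} = h k"
    proof -
      have "sum h {..<k} = 0" by (rule sum.neutral) (auto simp: h_def dg_def indicator_def lt)
      then show ?thesis by simp
    qed
    finally have 1: "e p - e q = (\<Sum>j. h (j + Suc k)) + h k" .
    have 2: "\<bar>h k\<bar> = (1/3)^k" using k by (auto simp: h_def dg_def indicator_def)
    have geo': "(\<lambda>j. (1/3::real)^(j + Suc k)) sums ((3/2) * (1/3)^Suc k)"
      using sums_mult2[OF geo, of "(1/3)^Suc k"] by (simp only: power_add)
    have le: "norm (h (j + Suc k)) \<le> (1/3)^(j + Suc k)" for j
      unfolding h_def dg_def indicator_def by auto
    have "\<bar>\<Sum>j. h (j + Suc k)\<bar> \<le> (\<Sum>j. (1/3::real)^(j + Suc k))"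
    proof -
      have sn: "summable (\<lambda>j. norm (h (j + Suc k)))"
        by (rule summable_comparison_test'[OF sums_summable[OF geo'], of 0]) (use le in simp)
      show ?thesis
        using order_trans[OF summable_norm[OF sn] suminf_le[OF le sn sums_summable[OF geo']]] by simp
    qed
    also have "\<dots> = (1/3)^k / 2" using sums_unique[OF geo'] by simp
    finally show ?thesis using 1 2 by linarith
  qed
  have "\<exists>s>0. \<forall>p\<in>F. \<forall>q\<in>F. \<bar>e p - e q\<bar> < s \<longrightarrow> dist p q < r" if r: "r > 0" for r
  proof -
    \<comment> \<open>Indices of base sets whose points are pairwise closer than \<open>r\<close>.
      Finitely many of them cover \<open>F\<close>; if p and q agree in all digits up to the largest
      such index, they lie in a common one of these sets.\<close>
    define N where "N = {k. \<forall>x\<in>A k. \<forall>y\<in>A k. dist x y < r}"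
    have "F \<subseteq> (\<Union>k\<in>N. A k)"
    proof
      fix x assume "x \<in> F"
      obtain b where b: "b \<in> B" "x \<in> b" "b \<subseteq> ball x (r/2)"
        using topological_basisE[OF B(2) open_ball[of x "r/2"], of x] r by auto
      then obtain k where "b = A k" using A by blast
      moreover have "dist y z < r" if "y \<in> b" "z \<in> b" for y z
        using that b(3) dist_triangle_half_r[of x y r z] by (auto simp: subset_iff)
      ultimately show "x \<in> (\<Union>k\<in>N. A k)" using b(2) by (auto simp: N_def)
    qed
    moreover have "open (A k)" for k using topological_basis_open[OF B(2)] A by blast
    ultimately obtain N' where N': "N' \<subseteq> N" "finite N'" "F \<subseteq> (\<Union>k\<in>N'. A k)"
      using compactE_image[OF assms, of N A] by metis
    define m where "m = Max (insert 0 N')"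
    have m: "k \<le> m" if "k \<in> N'" for k using N'(2) that by (simp add: m_def)
    have "dist p q < r" if pq: "p \<in> F" "q \<in> F" "\<bar>e p - e q\<bar> < (1/3)^m / 2" for p q
    proof -
      have agree: "(p \<in> A k) = (q \<in> A k)" if "k \<le> m" for k
      proof (rule ccontr)
        assume ne: "(p \<in> A k) \<noteq> (q \<in> A k)"
        define j where "j = (LEAST j. (p \<in> A j) \<noteq> (q \<in> A j))"
        have j: "(p \<in> A j) \<noteq> (q \<in> A j)" unfolding j_def using ne by (rule LeastI)
        have "(p \<in> A i) = (q \<in> A i)" if "i < j" for i using not_less_Least[of i] that unfolding j_def by blast
        from differ[OF j this] have "(1/3)^j / 2 \<le> \<bar>e p - e q\<bar>" .
        moreover have "j \<le> k" unfolding j_def using ne by (rule Least_le)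
        then have "(1/3::real)^m \<le> (1/3)^j" using \<open>k \<le> m\<close> by (intro power_decreasing) auto
        ultimately show False using pq(3) by simp
      qed
      obtain k where k: "k \<in> N'" "p \<in> A k" using N'(3) pq(1) by blast
      then have "q \<in> A k" using agree[OF m[OF k(1)]] by simp
      then show ?thesis using k N'(1) by (auto simp: N_def)
    qed
    then show ?thesis by (intro exI[of _ "(1/3)^m / 2"]) auto
  qed
  then show thesis using that e02 by blast
qed

text \<open>In \<open>ennreal\<close> the inverse is continuous with value \<infinity> at 0, so the
  regularised kernels actually converge, on the diagonal too. The liminf form is the one that
  Fatou's lemma takes.\<close>

lemma newton_kernel_le_liminf:
  fixes x y :: "'a::euclidean_space"
  assumes "DIM('a) \<ge> 2" "X \<longlonglongrightarrow> x" "Y \<longlonglongrightarrow> y" "d \<longlonglongrightarrow> 0"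
    and pos: "\<And>k. d k > 0"
  shows "newton_kernel x y \<le> liminf (\<lambda>k. ennreal (kern (d k) (X k - Y k)))"
proof -
  define n where "n = DIM('a) - 2"
  define s where "s k = sqrt ((norm (X k - Y k))\<^sup>2 + (d k)\<^sup>2)" for k
  have s: "s k > 0" for k using base_pos[OF pos] by (simp add: s_def)
  have kern: "ennreal (kern (d k) (X k - Y k)) = inverse (ennreal (s k ^ n))" for k
  proof -
    have "kern (d k) (X k - Y k) = inverse (((norm (X k - Y k))\<^sup>2 + (d k)\<^sup>2) powr (real n / 2))"
      by (simp add: kern_def n_def powr_minus)
    also have "((norm (X k - Y k))\<^sup>2 + (d k)\<^sup>2) powr (real n / 2) = s k powr real n"
      unfolding s_def powr_half_sqrt[OF less_imp_le[OF base_pos[OF pos]], symmetric] by (simp add: powr_powr)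
    also have "\<dots> = s k ^ n" using s by (rule powr_realpow)
    finally show ?thesis using s by (simp add: inverse_ennreal)
  qed
  have "s \<longlonglongrightarrow> sqrt ((norm (x - y))\<^sup>2 + 0\<^sup>2)"
    unfolding s_def by (intro tendsto_intros assms)
  then have "(\<lambda>k. ennreal (s k ^ n)) \<longlonglongrightarrow> ennreal (norm (x - y) ^ n)"
    by (intro tendsto_ennrealI tendsto_power) simp
  then have "(\<lambda>k. inverse (ennreal (s k ^ n))) \<longlonglongrightarrow> inverse (ennreal (norm (x - y) ^ n))"
    using continuous_on_inverse_ennreal[OF continuous_on_id, of UNIV]
    by (intro isCont_tendsto_compose[where g=inverse]) (auto simp: continuous_on_eq_continuous_at)
  then have "liminf (\<lambda>k. ennreal (kern (d k) (X k - Y k))) = inverse (ennreal (norm (x - y) ^ n))"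
    unfolding kern by (rule lim_imp_Liminf[rotated]) simp
  then show ?thesis by (simp add: newton_kernel_def n_def ennreal_power)
qed

lemma newton_kernel_measurable [measurable]:
  "(\<lambda>(x, y). newton_kernel x y) \<in> borel_measurable (borel \<Otimes>\<^sub>M (borel :: 'a::euclidean_space measure))"
  unfolding newton_kernel_def by measurable

text \<open>Helly's selection theorem and Skorohod's representation concern the real line, so the measures are
  transported to the line and back by the code.\<close>

lemma energy_limit:
  fixes F :: "'a::euclidean_space set"
  assumes n: "DIM('a) \<ge> 2" and F: "compact F" and d: "\<And>k. d k > 0" "d \<longlonglongrightarrow> 0"
    and Sw: "\<And>k. fin_prob F (S k) (w k)" and M: "\<And>k. fin_energy (d k) (S k) (w k) \<le> M"
  obtains \<nu> :: "'a measure"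
  where "prob_space \<nu>" "sets \<nu> = sets borel" "emeasure \<nu> (- F) = 0" "energy \<nu> \<le> ennreal M"
proof -
  obtain e :: "'a \<Rightarrow> real" where e02: "\<And>x. 0 \<le> e x \<and> e x \<le> 2"
    and e: "\<And>r. r > 0 \<Longrightarrow> \<exists>s>0. \<forall>p\<in>F. \<forall>q\<in>F. \<bar>e p - e q\<bar> < s \<longrightarrow> dist p q < r"
    using exists_real_code[OF F] by blast
  have inj: "inj_on e F"
  proof (rule inj_onI, rule ccontr)
    fix p q assume pq: "p \<in> F" "q \<in> F" "e p = e q" "p \<noteq> q"
    then obtain s where "s > 0" "\<And>p' q'. p' \<in> F \<Longrightarrow> q' \<in> F \<Longrightarrow> \<bar>e p' - e q'\<bar> < s \<Longrightarrow> dist p' q' < dist p q"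
      using e[of "dist p q"] by auto
    from this(2)[of p q] this(1) pq show False by simp
  qed
  have S: "finite (S k)" "S k \<subseteq> F" "\<And>a. a \<in> S k \<Longrightarrow> 0 \<le> w k a" "sum (w k) (S k) = 1" for k
    using Sw[of k] by (auto simp: fin_prob_def)
  \<comment> \<open>On a \<open>pmf\<close> every set is measurable, so the code \<open>e\<close>
    can push the measure forward without a measurability proof.\<close>
  define pw where "pw k = embed_pmf (\<lambda>a. if a \<in> S k then w k a else 0)" for k
  have pmf: "pmf (pw k) a = (if a \<in> S k then w k a else 0)" for k a
    unfolding pw_def
  proof (rule pmf_embed_pmf)
    have "(\<integral>\<^sup>+x. ennreal (if x \<in> S k then w k x else 0) \<partial>count_space UNIV) = (\<Sum>x\<in>S k. ennreal (w k x))"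
      using S(1)[of k] by (subst nn_integral_count_space'[of "S k"]) (auto intro: sum.cong)
    also have "\<dots> = 1" using S(3,4) by (subst sum_ennreal) auto
    finally show "(\<integral>\<^sup>+x. ennreal (if x \<in> S k then w k x else 0) \<partial>count_space UNIV) = 1" .
  qed (use S in auto)
  have set: "set_pmf (pw k) \<subseteq> S k" for k by (auto simp: set_pmf_eq pmf split: if_splits)
  define Q where "Q k = distr (measure_pmf (pw k)) borel e" for k
  have Q: "real_distribution (Q k)" for k
    unfolding Q_def by (rule prob_space.real_distribution_distr) (simp_all add: measure_pmf.prob_space_axioms)
  have nnQ: "(\<integral>\<^sup>+y. f y \<partial>Q k) = (\<Sum>a\<in>S k. ennreal (w k a) * f (e a))" if [measurable]: "f \<in> borel_measurable borel" for f k
  proof -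
    have "(\<integral>\<^sup>+y. f y \<partial>Q k) = (\<integral>\<^sup>+a. f (e a) \<partial>measure_pmf (pw k))"
      unfolding Q_def by (subst nn_integral_distr) auto
    also have "\<dots> = (\<Sum>a\<in>S k. f (e a) * pmf (pw k) a)"
      by (rule nn_integral_measure_pmf_support) (use S(1) subsetD[OF set[of k]] in auto)
    also have "\<dots> = (\<Sum>a\<in>S k. ennreal (w k a) * f (e a))"
      by (intro sum.cong) (auto simp: pmf mult.commute)
    finally show ?thesis .
  qed
  have "tight Q"
    unfolding tight_def
  proof (intro conjI allI impI Q)
    fix \<epsilon> :: real assume "\<epsilon> > 0"
    \<comment> \<open>Tightness is stated with left-open intervals, so the lower end has to lie
      below the smallest possible code 0.\<close>
    have "measure (Q k) {-1<..2} = 1" for k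
    proof -
      have "e x \<in> {-1<..2}" for x using e02[of x] by simp
      then have "e -` {-1<..2} = UNIV" by blast
      then show ?thesis unfolding Q_def by (subst measure_distr) auto
    qed
    then show "\<exists>a b. a < b \<and> (\<forall>k. 1 - \<epsilon> < measure (Q k) {a<..b})"
      using \<open>\<epsilon> > 0\<close> by (intro exI[of _ "-1"] exI[of _ 2]) auto
  qed
  then obtain r L where r: "strict_mono (r :: nat \<Rightarrow> nat)" and L: "real_distribution L" "weak_conv_m (Q \<circ> id \<circ> r) L"
    using tight_imp_convergent_subsubsequence[of Q id] strict_mono_id by blast
  have Qr: "real_distribution ((Q \<circ> id \<circ> r) k)" for k using Q by simp
  obtain \<Omega> :: "real measure" and Y Y' where \<Omega>: "prob_space \<Omega>"
    and Y[measurable]: "\<And>k. Y k \<in> measurable \<Omega> borel" and YQ: "\<And>k. distr \<Omega> borel (Y k) = Q (r k)"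
    and conv: "\<And>\<omega>. \<omega> \<in> space \<Omega> \<Longrightarrow> (\<lambda>k. Y k \<omega>) \<longlonglongrightarrow> (Y' \<omega> :: real)"
    using Skorohod[OF Qr L] unfolding o_def id_apply by blast
  interpret \<Omega>: prob_space \<Omega> by (rule \<Omega>)
  \<comment> \<open>Decoding is restricted to the finitely many codes of \<open>S k\<close>: a
    function that differs from a constant at finitely many points is Borel, whatever the inverse of
    \<open>e\<close> on \<open>F\<close> looks like.\<close>
  define dec where "dec k y = (if y \<in> e ` S k then inv_into F e y else 0)" for k y
  have dec: "dec k (e a) = a" if "a \<in> S k" for k a
    using that inv_into_f_f[OF inj, of a] S(2)[of k] by (auto simp: dec_def)
  have [measurable]: "dec k \<in> borel_measurable borel" for k
    by (rule measurable_discrete_difference[where f="\<lambda>_. 0" and X="e ` S k"])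
       (use S(1) in \<open>auto simp: dec_def intro: countable_finite\<close>)
  define X where "X k \<omega> = dec (r k) (Y k \<omega>)" for k \<omega>
  have X[measurable]: "X k \<in> borel_measurable \<Omega>" for k unfolding X_def by measurable
  have law: "(\<integral>\<^sup>+\<omega>. f (X k \<omega>) \<partial>\<Omega>) = (\<Sum>a\<in>S (r k). ennreal (w (r k) a) * f a)"
    if [measurable]: "f \<in> borel_measurable borel" for f :: "'a \<Rightarrow> ennreal" and k
  proof -
    have "(\<integral>\<^sup>+\<omega>. f (X k \<omega>) \<partial>\<Omega>) = (\<integral>\<^sup>+y. f (dec (r k) y) \<partial>distr \<Omega> borel (Y k))"
      unfolding X_def by (subst nn_integral_distr) auto
    also have "\<dots> = (\<Sum>a\<in>S (r k). ennreal (w (r k) a) * f a)"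
      unfolding YQ by (subst nnQ) (auto simp: dec)
    finally show ?thesis .
  qed
  have "AE \<omega> in \<Omega>. Y k \<omega> \<in> e ` S (r k)" for k
  proof -
    have fin: "finite (e ` S (r k))" using S(1) by simp
    have "AE y in distr \<Omega> borel (Y k). y \<in> e ` S (r k)"
      unfolding YQ Q_def using set[of "r k"] fin
      by (subst AE_distr_iff) (auto simp: AE_measure_pmf_iff intro: borel_closed finite_imp_closed)
    then show ?thesis by (subst (asm) AE_distr_iff) (use fin in \<open>auto intro: borel_closed finite_imp_closed\<close>)
  qed
  then have AEY: "AE \<omega> in \<Omega>. \<forall>k. Y k \<omega> \<in> e ` S (r k)" by (simp add: AE_all_countable)
  \<comment> \<open>Total and measurable by definition. Almost surely it is a genuine limit: the
    codes converge, and closeness of codes forces closeness of points of \<open>F\<close>, so the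
    decoded sequence is Cauchy.\<close>
  define X' where "X' \<omega> = lim (\<lambda>k. X k \<omega>)" for \<omega>
  have X'[measurable]: "X' \<in> borel_measurable \<Omega>" unfolding X'_def by measurable
  have AEX: "AE \<omega> in \<Omega>. (\<lambda>k. X k \<omega>) \<longlonglongrightarrow> X' \<omega> \<and> X' \<omega> \<in> F"
    using AEY AE_space
  proof eventually_elim
    case (elim \<omega>)
    have XF: "X k \<omega> \<in> F" and eX: "e (X k \<omega>) = Y k \<omega>" for k
    proof -
      obtain a where "a \<in> S (r k)" "Y k \<omega> = e a" using elim(1) by blast
      then show "X k \<omega> \<in> F" "e (X k \<omega>) = Y k \<omega>" using dec S(2) by (auto simp: X_def)
    qed
    have C: "Cauchy (\<lambda>k. Y k \<omega>)" using conv[OF elim(2)] by (rule LIMSEQ_imp_Cauchy)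
    have "Cauchy (\<lambda>k. X k \<omega>)"
    proof (rule metric_CauchyI)
      fix \<epsilon> :: real assume "\<epsilon> > 0"
      then obtain s where s: "s > 0" "\<And>p q. p \<in> F \<Longrightarrow> q \<in> F \<Longrightarrow> \<bar>e p - e q\<bar> < s \<Longrightarrow> dist p q < \<epsilon>"
        using e[of \<epsilon>] by blast
      obtain N where N: "\<And>i j. i \<ge> N \<Longrightarrow> j \<ge> N \<Longrightarrow> dist (Y i \<omega>) (Y j \<omega>) < s"
        using metric_CauchyD[OF C s(1)] by blast
      then show "\<exists>N. \<forall>i\<ge>N. \<forall>j\<ge>N. dist (X i \<omega>) (X j \<omega>) < \<epsilon>"
        using s(2)[OF XF XF] N unfolding eX dist_real_def by blast
    qed
    then have "convergent (\<lambda>k. X k \<omega>)" by (rule Cauchy_convergent)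
    then have l: "(\<lambda>k. X k \<omega>) \<longlonglongrightarrow> X' \<omega>" unfolding X'_def by (simp add: convergent_LIMSEQ_iff)
    moreover have "X' \<omega> \<in> F"
      using closed_sequentially[OF compact_imp_closed[OF F] _ l] XF by blast
    ultimately show ?case by blast
  qed
  define \<nu> where "\<nu> = distr \<Omega> borel X'"
  interpret \<nu>: prob_space \<nu> unfolding \<nu>_def by (rule \<Omega>.prob_space_distr) simp
  have s\<nu>[measurable_cong]: "sets \<nu> = sets borel" by (simp add: \<nu>_def)
  have "AE x in \<nu>. x \<in> F"
    unfolding \<nu>_def using AEX compact_imp_closed[OF F]
    by (subst AE_distr_iff) (auto intro: borel_closed)
  then have null: "emeasure \<nu> (- F) = 0"
    using AE_iff_measurable[of "- F" \<nu> "\<lambda>x. x \<in> F"] compact_imp_closed[OF F]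
    by (auto simp: \<nu>_def)
  have dr: "(\<lambda>k. d (r k)) \<longlonglongrightarrow> 0" using LIMSEQ_subseq_LIMSEQ[OF d(2) r] by (simp add: o_def)
  have km: "(\<lambda>b. ennreal (kern \<delta> (a - b))) \<in> borel_measurable borel" for \<delta> and a :: 'a
    unfolding kern_def by measurable
  define u where "u k x = (\<Sum>b\<in>S (r k). ennreal (w (r k) b) * ennreal (kern (d (r k)) (x - b)))" for k x
  have um[measurable]: "u k \<in> borel_measurable borel" for k
    unfolding u_def kern_def by measurable
  \<comment> \<open>Integrating twice over \<Omega> amounts to two independent samples of one law,
    so every energy is an iterated integral. Fatou's lemma is applied to the inner integral and then
    to the outer one.\<close>
  have "energy \<nu> = (\<integral>\<^sup>+\<omega>. (\<integral>\<^sup>+\<omega>'. newton_kernel (X' \<omega>) (X' \<omega>') \<partial>\<Omega>) \<partial>\<Omega>)"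
    unfolding energy_def \<nu>_def by (subst nn_integral_distr nn_integral_distr; measurable)+
  also have "\<dots> \<le> (\<integral>\<^sup>+\<omega>. liminf (\<lambda>k. u k (X k \<omega>)) \<partial>\<Omega>)"
  proof (rule nn_integral_mono_AE)
    show "AE \<omega> in \<Omega>. (\<integral>\<^sup>+\<omega>'. newton_kernel (X' \<omega>) (X' \<omega>') \<partial>\<Omega>) \<le> liminf (\<lambda>k. u k (X k \<omega>))"
      using AEX
    proof eventually_elim
      case (elim \<omega>)
      have "(\<integral>\<^sup>+\<omega>'. newton_kernel (X' \<omega>) (X' \<omega>') \<partial>\<Omega>) \<le>
        (\<integral>\<^sup>+\<omega>'. liminf (\<lambda>k. ennreal (kern (d (r k)) (X k \<omega> - X k \<omega>'))) \<partial>\<Omega>)"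
      proof (rule nn_integral_mono_AE)
        show "AE \<omega>' in \<Omega>. newton_kernel (X' \<omega>) (X' \<omega>') \<le> liminf (\<lambda>k. ennreal (kern (d (r k)) (X k \<omega> - X k \<omega>')))"
          using AEX
        proof eventually_elim
          case (elim \<omega>')
          then show ?case
            using newton_kernel_le_liminf[OF n _ _ dr d(1)] \<open>(\<lambda>k. X k \<omega>) \<longlonglongrightarrow> X' \<omega> \<and> X' \<omega> \<in> F\<close> by blast
        qed
      qed
      also have "\<dots> \<le> liminf (\<lambda>k. \<integral>\<^sup>+\<omega>'. ennreal (kern (d (r k)) (X k \<omega> - X k \<omega>')) \<partial>\<Omega>)"
        by (rule nn_integral_liminf) (rule measurable_compose[OF X km])
      also have "\<dots> = liminf (\<lambda>k. u k (X k \<omega>))"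
        unfolding u_def by (subst law[OF km]) simp
      finally show ?case .
    qed
  qed
  also have "\<dots> \<le> liminf (\<lambda>k. \<integral>\<^sup>+\<omega>. u k (X k \<omega>) \<partial>\<Omega>)"
    by (rule nn_integral_liminf) (rule measurable_compose[OF X um])
  also have "\<dots> \<le> ennreal M"
  proof (rule Liminf_le)
    have "(\<integral>\<^sup>+\<omega>. u k (X k \<omega>) \<partial>\<Omega>) = ennreal (fin_energy (d (r k)) (S (r k)) (w (r k)))" for k
      unfolding law[OF um] unfolding u_def fin_energy_def using S(3)
      by (simp add: ennreal_mult'[symmetric] sum_nonneg mult_nonneg_nonneg cong: sum.cong)
    then show "\<forall>\<^sub>F k in sequentially. (\<integral>\<^sup>+\<omega>. u k (X k \<omega>) \<partial>\<Omega>) \<le> ennreal M"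
      using M by (simp add: ennreal_leI)
  qed simp
  finally show thesis using that \<nu>.prob_space_axioms s\<nu> null by blast
qed

text \<open>If no \<open>d\<close> made all discrete energies at least \<open>M\<close>, the choices
  1, 1/2, 1/3, ... would produce a limit measure contradicting \<open>en\<close>. For a suitable
  \<open>d\<close> some probability has potential at least \<open>M / 2\<close> on \<open>F\<close>;
  multiplied by \<open>3 / M\<close> it is at least 3/2, safely above 1.\<close>

lemma exists_small_potential:
  fixes F :: "'a::euclidean_space set"
  assumes n: "DIM('a) \<ge> 2" and F: "compact F" and M: "M > 0"
    and en: "\<And>\<nu> :: 'a measure. prob_space \<nu> \<Longrightarrow> sets \<nu> = sets borel \<Longrightarrow> emeasure \<nu> (- F) = 0 \<Longrightarrow> energy \<nu> > ennreal M"
  shows "\<exists>d S w. d > 0 \<and> finite S \<and> S \<subseteq> F \<and> (\<forall>a\<in>S. 0 \<le> w a) \<and> sum w S \<le> 3 / M \<and>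
    (\<forall>p\<in>F. 1 < (\<Sum>a\<in>S. w a * kern d (p - a)))"
proof (cases "F = {}")
  case True
  then show ?thesis using M by (intro exI[of _ 1] exI[of _ "{}"]) auto
next
  case False
  have "\<exists>d>0. \<forall>S w. fin_prob F S w \<longrightarrow> M \<le> fin_energy d S w"
  proof (rule ccontr)
    assume neg: "\<not> ?thesis"
    have "\<exists>S w. fin_prob F S w \<and> fin_energy (1 / real (Suc k)) S w \<le> M" for k
      using neg by (meson linear zero_less_divide_1_iff of_nat_0_less_iff zero_less_Suc)
    then obtain S w where Sw: "\<And>k. fin_prob F (S k) (w k)" "\<And>k. fin_energy (1 / real (Suc k)) (S k) (w k) \<le> M"
      by metis
    have lim: "(\<lambda>k. 1 / real (Suc k)) \<longlonglongrightarrow> 0" using LIMSEQ_Suc[OF lim_1_over_n] by simp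
    have pos: "1 / real (Suc k) > 0" for k by simp
    obtain \<nu> :: "'a measure" where "prob_space \<nu>" "sets \<nu> = sets borel" "emeasure \<nu> (- F) = 0" "energy \<nu> \<le> ennreal M"
      by (rule energy_limit[OF n F pos lim Sw])
    then show False using en[of \<nu>] by simp
  qed
  then obtain d where d: "d > 0" "\<And>S w. fin_prob F S w \<Longrightarrow> M \<le> fin_energy d S w" by blast
  obtain S w where Sw: "fin_prob F S w" "\<And>p. p \<in> F \<Longrightarrow> M / 2 \<le> (\<Sum>a\<in>S. w a * kern d (p - a))"
    using exists_large_potential[OF False M d(2)] by blast
  have "1 < (\<Sum>a\<in>S. (3 / M * w a) * kern d (p - a))" if "p \<in> F" for p
  proof -
    have "1 < 3 / M * (M / 2)" using M by simp
    also have "\<dots> \<le> 3 / M * (\<Sum>a\<in>S. w a * kern d (p - a))" using Sw(2)[OF that] M by (intro mult_left_mono) auto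
    finally show ?thesis by (simp only: sum_distrib_left mult.assoc)
  qed
  moreover have "sum (\<lambda>a. 3 / M * w a) S \<le> 3 / M"
  proof -
    have "sum (\<lambda>a. 3 / M * w a) S = 3 / M * sum w S" by (simp only: sum_distrib_left)
    then show ?thesis using Sw(1) by (simp add: fin_prob_def)
  qed
  ultimately show ?thesis
    using d(1) Sw(1) M by (intro exI[of _ d] exI[of _ S] exI[of _ "\<lambda>a. 3 / M * w a"]) (auto simp: fin_prob_def)
qed

section \<open>Cutting off a test function near a set of small capacity\<close>

text \<open>For p = 1 this is the cutoff of the overview; the 1 in the exponent normalises its value
  at 0. The polynomial in \<open>1 / (1 - t)\<close> makes the family closed under differentiation,
  as \<open>C_k_compose\<close> requires.\<close>

definition flat :: "real poly \<Rightarrow> real \<Rightarrow> real"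
  where "flat p t = (if t < 1 then poly p (1 / (1 - t)) * exp (1 - 1 / (1 - t)) else 0)"

lemma poly_exp_tendsto_0: "((\<lambda>s::real. poly p s * exp (1 - s)) \<longlongrightarrow> 0) at_top"
proof -
  have "((\<lambda>s::real. exp 1 * (\<Sum>i\<le>degree p. coeff p i * (s ^ i / exp s))) \<longlongrightarrow> exp 1 * (\<Sum>i\<le>degree p. coeff p i * 0)) at_top"
    by (intro tendsto_intros tendsto_power_div_exp_0)
  moreover have "exp 1 * (\<Sum>i\<le>degree p. coeff p i * (s ^ i / exp s)) = poly p s * exp (1 - s)" for s :: real
    by (simp add: poly_altdef exp_diff sum_distrib_right sum_distrib_left field_simps)
  ultimately show ?thesis by simp
qed

text \<open>With \<open>s = 1 / (1 - t)\<close> one has s' = s^2, which is the factor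
  \<open>[:0, 0, 1:]\<close>. At t = 1 the left difference quotient only multiplies \<open>p\<close>
  by -s, and the exponential still wins as s tends to infinity.\<close>

lemma flat_has_derivative: "(flat p has_real_derivative flat ((pderiv p - p) * [:0, 0, 1:]) t) (at t)"
proof -
  consider "t < 1" | "t > 1" | "t = 1" by linarith
  then show ?thesis
  proof cases
    case 1
    define s where "s = 1 / (1 - t)"
    have "((\<lambda>t. 1 / (1 - t)) has_real_derivative s\<^sup>2) (at t)"
      using 1 by (auto intro!: derivative_eq_intros simp: s_def power2_eq_square)
    from DERIV_mult[OF DERIV_chain2[OF poly_DERIV this] DERIV_chain2[OF DERIV_exp DERIV_diff[OF DERIV_const this]]]
    have "((\<lambda>t. poly p (1 / (1 - t)) * exp (1 - 1 / (1 - t))) has_real_derivative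
        flat ((pderiv p - p) * [:0, 0, 1:]) t) (at t)"
      using 1 by (simp add: flat_def s_def[symmetric] power2_eq_square algebra_simps)
    then show ?thesis
      by (rule has_field_derivative_transform_within_open[of _ _ _ "{..<1}"]) (use 1 in \<open>auto simp: flat_def\<close>)
  next
    case 2
    have "((\<lambda>t. 0) has_real_derivative flat ((pderiv p - p) * [:0, 0, 1:]) t) (at t)"
      using 2 by (simp add: flat_def)
    then show ?thesis
      by (rule has_field_derivative_transform_within_open[of _ _ _ "{1<..}"]) (use 2 in \<open>auto simp: flat_def\<close>)
  next
    case 3
    have "((\<lambda>h. flat p (1 + h) / h) \<longlongrightarrow> 0) (at_right 0)"
    proof (rule tendsto_eventually)
      show "\<forall>\<^sub>F h in at_right 0. flat p (1 + h) / h = 0"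
        using eventually_at_right_less[of "0::real"] by eventually_elim (simp add: flat_def)
    qed
    moreover have "((\<lambda>h. flat p (1 + h) / h) \<longlongrightarrow> 0) (at_left 0)"
    proof -
      have lim: "filterlim (\<lambda>h::real. - inverse h) at_top (at_left 0)"
        using filterlim_inverse_at_bot_neg by (simp add: filterlim_uminus_at_top)
      have "((\<lambda>s. - (poly (p * [:0, 1:]) s * exp (1 - s))) \<longlongrightarrow> - 0) at_top"
        by (intro tendsto_minus poly_exp_tendsto_0)
      from filterlim_compose[OF this lim]
      have "((\<lambda>h. - (poly (p * [:0, 1:]) (- inverse h) * exp (1 + inverse h))) \<longlongrightarrow> 0) (at_left 0)"
        by simp
      moreover have "\<forall>\<^sub>F h in at_left 0. - (poly (p * [:0, 1:]) (- inverse h) * exp (1 + inverse h)) = flat p (1 + h) / h"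
      proof -
        have "\<forall>\<^sub>F h in at_left 0. h < (0::real)" by (simp add: eventually_at_filter)
        then show ?thesis by eventually_elim (simp add: flat_def field_simps)
      qed
      ultimately show ?thesis by (rule Lim_transform_eventually)
    qed
    ultimately have "((\<lambda>h. flat p (1 + h) / h) \<longlongrightarrow> 0) (at 0)"
      by (simp add: filterlim_at_split)
    then show ?thesis using 3 by (simp add: DERIV_def flat_def)
  qed
qed

lemma smooth_flat: "smooth h \<Longrightarrow> smooth (\<lambda>x. flat p (h x))"
proof
  fix k assume h: "smooth h"
  show "C_k k (\<lambda>x. flat p (h x))"
  proof (rule C_k_compose[where G="range flat" and T=UNIV, OF rangeI h UNIV_I])
    fix g :: "real \<Rightarrow> real" assume "g \<in> range flat"
    then obtain p where "g = flat p" by blast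
    then show "\<exists>g'\<in>range flat. \<forall>t\<in>UNIV. (g has_real_derivative g' t) (at t)"
      using flat_has_derivative[of p] by blast
  qed
qed

lemma flat_1:
  assumes "t \<ge> 0" shows "0 \<le> flat 1 t" "flat 1 t \<le> 1"
proof -
  have "1 \<le> 1 / (1 - t)" if "t < 1" using assms that by (simp add: le_divide_eq)
  then show "0 \<le> flat 1 t" "flat 1 t \<le> 1" by (auto simp: flat_def)
qed

text \<open>The derivative is continuous on [0, 1] and zero beyond, hence bounded for t \<ge> 0; the
  mean value theorem starts from the value 1 at 0.\<close>

lemma flat_1_lipschitz:
  obtains L where "L \<ge> 0" "\<And>t. t \<ge> 0 \<Longrightarrow> \<bar>flat ((pderiv 1 - 1) * [:0, 0, 1:]) t\<bar> \<le> L"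
    "\<And>t. t \<ge> 0 \<Longrightarrow> 1 - flat 1 t \<le> L * t"
proof -
  define q :: "real poly" where "q = (pderiv 1 - 1) * [:0, 0, 1:]"
  have d: "(flat 1 has_real_derivative flat q t) (at t)" for t
    unfolding q_def by (rule flat_has_derivative)
  have "continuous_on {0..1} (flat q)"
    using flat_has_derivative by (meson DERIV_continuous_on has_field_derivative_at_within)
  from compact_imp_bounded[OF compact_continuous_image[OF this compact_Icc]]
  obtain L where L: "\<forall>y\<in>flat q ` {0..1}. norm y \<le> L"
    unfolding bounded_iff by (elim exE)
  have L0: "L \<ge> 0" using L norm_ge_zero[of "flat q 0"] by (meson atLeastAtMost_iff image_eqI order.refl order_trans zero_le_one)
  have bd: "\<bar>flat q t\<bar> \<le> L" if "t \<ge> 0" for t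
  proof (cases "t \<le> 1")
    case True
    then show ?thesis using L[rule_format, of "flat q t"] that by simp
  qed (use L0 in \<open>simp add: flat_def\<close>)
  have "1 - flat 1 t \<le> L * t" if "t \<ge> 0" for t
  proof (cases "t = 0")
    case False
    then have "t > 0" using that by simp
    then have "\<exists>z>0. z < t \<and> flat 1 t - flat 1 0 = (t - 0) * flat q z"
      by (intro MVT2) (use d in auto)
    then obtain z where z: "z > 0" "flat 1 t - flat 1 0 = t * flat q z" by auto
    have "- flat q z \<le> L" using bd[of z] z(1) by linarith
    then have "t * (- flat q z) \<le> t * L" using that by (rule mult_left_mono)
    then show ?thesis using z(2) by (simp add: flat_def mult.commute)
  qed (simp add: flat_def)
  then show thesis using that L0 bd by (simp add: q_def)
qed

section \<open>Laplacians of linear combinations and of \<open>exp (- g)\<close>\<close>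

lemma dd_linear_combination:
  assumes "\<And>i. i \<in> I \<Longrightarrow> smooth (f i)"
  shows "dd (\<lambda>x. \<Sum>i\<in>I. c i * f i x) b x = (\<Sum>i\<in>I. c i * dd (f i) b x)"
  by (rule dd_eq) (intro has_derivative_sum has_derivative_mult_right smooth_has_derivative assms)

lemma smooth_linear_combination:
  "(\<And>i. i \<in> I \<Longrightarrow> smooth (f i)) \<Longrightarrow> smooth (\<lambda>x. \<Sum>i\<in>I. c i * f i x)"
  by (intro allI C_k_sum C_k_mult C_k_const) auto

lemma lap_linear_combination:
  assumes f: "\<And>i. i \<in> I \<Longrightarrow> smooth (f i)"
  shows "lap (\<lambda>x. \<Sum>i\<in>I. c i * f i x) x = (\<Sum>i\<in>I. c i * lap (f i) x)"
proof -
  have "dd (dd (\<lambda>x. \<Sum>i\<in>I. c i * f i x) b) b x = (\<Sum>i\<in>I. c i * dd (dd (f i) b) b x)" if b: "b \<in> Basis" for b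
  proof -
    have 1: "dd (\<lambda>x. \<Sum>i\<in>I. c i * f i x) b = (\<lambda>x. \<Sum>i\<in>I. c i * dd (f i) b x)"
      by (intro ext dd_linear_combination f)
    show ?thesis unfolding 1
      by (rule dd_linear_combination[where f="\<lambda>i. dd (f i) b"]) (rule smooth_dd[OF f b])
  qed
  then have "lap (\<lambda>x. \<Sum>i\<in>I. c i * f i x) x = (\<Sum>b\<in>Basis. \<Sum>i\<in>I. c i * dd (dd (f i) b) b x)"
    by (simp add: lap_def)
  also have "\<dots> = (\<Sum>i\<in>I. c i * lap (f i) x)"
    unfolding lap_def sum_distrib_left by (rule sum.swap)
  finally show ?thesis .
qed

text \<open>The shift by -1 matters later: once Green's identity has moved the Laplacian away,
  \<open>\<bar>exp (- g) - 1\<bar> \<le> g\<close> makes the remaining factor small where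
  \<open>g\<close> is small.\<close>

lemma smooth_exp_minus:
  assumes "smooth g" shows "smooth (\<lambda>x. exp (- g x) - 1)"
proof -
  define G where "G = range (\<lambda>c t::real. c * exp (- t))"
  have "\<exists>g'\<in>G. \<forall>t\<in>UNIV. (h has_real_derivative g' t) (at t)" if hG: "h \<in> G" for h
  proof -
    obtain c where "h = (\<lambda>t. c * exp (- t))" using hG unfolding G_def by blast
    then have "(h has_real_derivative (- c) * exp (- t)) (at t)" for t
      by (auto intro!: derivative_eq_intros)
    then show ?thesis by (intro bexI[of _ "\<lambda>t. (- c) * exp (- t)"]) (auto simp: G_def intro!: range_eqI[of _ _ "- c"])
  qed
  moreover have "(\<lambda>t. 1 * exp (- t)) \<in> G" unfolding G_def by blast
  ultimately have "C_k k (\<lambda>x. 1 * exp (- g x))" for k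
    by (intro C_k_compose[of "\<lambda>t. 1 * exp (- t)" G _ UNIV] assms) auto
  then have "C_k k (\<lambda>x. 1 * exp (- g x) + (- 1))" for k by (intro C_k_add C_k_const)
  then show ?thesis by simp
qed

text \<open>For superharmonic \<open>g\<close> both terms are nonnegative, so this Laplacian
  dominates the weighted square of the gradient.\<close>

lemma lap_exp_minus:
  assumes g: "smooth g"
  shows "lap (\<lambda>x. exp (- g x) - 1) x = exp (- g x) * ((norm (gradient g x))\<^sup>2 - lap g x)"
proof -
  have 1: "dd (\<lambda>x. exp (- g x) - 1) b x = (- exp (- g x)) * dd g b x" for b x
    by (rule dd_compose[where g="\<lambda>t. exp (- t) - 1", OF _ g]) (auto intro!: derivative_eq_intros)
  have E: "smooth (\<lambda>x. - exp (- g x))"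
  proof -
    have "C_k k (\<lambda>x. (- 1) * (exp (- g x) - 1) + (- 1))" for k
      by (intro C_k_add C_k_mult C_k_const smooth_exp_minus[OF g, rule_format])
    then show ?thesis by simp
  qed
  have 2: "dd (\<lambda>x. - exp (- g x)) b x = exp (- g x) * dd g b x" for b
    by (rule dd_compose[where g="\<lambda>t. - exp (- t)", OF _ g]) (auto intro!: derivative_eq_intros)
  have "dd (dd (\<lambda>x. exp (- g x) - 1) b) b x = exp (- g x) * ((dd g b x)\<^sup>2 - dd (dd g b) b x)"
    if b: "b \<in> Basis" for b
    unfolding 1 dd_mult[OF E smooth_dd[OF g b]] 2 by (simp add: power2_eq_square algebra_simps)
  then show ?thesis
    unfolding norm_gradient_sq lap_def
    by (simp add: sum_distrib_left[symmetric] sum_subtractf[symmetric])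
qed

text \<open>Testing the superharmonicity of \<open>g\<close> against \<open>\<phi>\<^sup>2 e\<^sup>-\<^sup>g\<close> bounds the weighted energy
  of \<open>g\<close> by an integral of \<open>1 - e\<^sup>-\<^sup>g \<le> g\<close>.\<close>

lemma superharmonic_energy_le:
  fixes \<phi> g :: "'a::euclidean_space \<Rightarrow> real"
  assumes \<phi>: "smooth \<phi>" and K: "compact K" "K \<subseteq> ball 0 1" "\<And>x. x \<notin> K \<Longrightarrow> \<phi> x = 0"
    and g: "smooth g" "\<And>x. 0 \<le> g x" "\<And>x. lap g x \<le> 0"
    and A: "0 \<le> A" "\<And>x. \<bar>lap (\<lambda>x. \<phi> x * \<phi> x) x\<bar> \<le> A"
    and int: "integrable lborel (\<lambda>x. indicator (ball 0 1) x * g x)"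
  shows "(LINT x|lborel. (\<phi> x)\<^sup>2 * (exp (- g x) * (norm (gradient g x))\<^sup>2)) \<le>
    A * (LINT x|lborel. indicator (ball 0 1) x * g x)"
proof -
  define W where "W x = exp (- g x) - 1" for x
  have W: "smooth W" unfolding W_def using smooth_exp_minus[OF g(1)] .
  have sm2: "smooth (\<lambda>x. \<phi> x * \<phi> x)" using C_k_mult \<phi> by blast
  have lap0: "lap (\<lambda>x. \<phi> x * \<phi> x) x = 0" if "x \<notin> K" for x
    by (rule lap_eq_0_outside[OF K(1) _ that]) (simp add: K(3))
  have "(LINT x|lborel. (\<phi> x)\<^sup>2 * (exp (- g x) * (norm (gradient g x))\<^sup>2)) \<le> (LINT x|lborel. \<phi> x * \<phi> x * lap W x)"
  proof (rule integral_mono)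
    show "integrable lborel (\<lambda>x. (\<phi> x)\<^sup>2 * (exp (- g x) * (norm (gradient g x))\<^sup>2))"
      by (rule integrable_compact_support[OF _ K(1)])
         (intro continuous_on_mult continuous_on_power continuous_on_exp continuous_on_minus
            continuous_on_norm gradient_continuous smooth_continuous \<phi> g(1), simp add: K)
    show "integrable lborel (\<lambda>x. \<phi> x * \<phi> x * lap W x)"
      by (rule integrable_compact_support[OF _ K(1)])
         (intro continuous_on_mult continuous_on_lap W smooth_continuous \<phi>, simp add: K)
    show "(\<phi> x)\<^sup>2 * (exp (- g x) * (norm (gradient g x))\<^sup>2) \<le> \<phi> x * \<phi> x * lap W x" for x
      unfolding W_def lap_exp_minus[OF g(1)] power2_eq_square[of "\<phi> x"] using g(3)[of x]
      by (intro mult_left_mono) auto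
  qed
  also have "\<dots> = (LINT x|lborel. W x * lap (\<lambda>x. \<phi> x * \<phi> x) x)"
    by (rule green[OF sm2 W K(1)]) (simp add: K)
  also have "\<dots> \<le> (LINT x|lborel. A * (indicator (ball 0 1) x * g x))"
  proof (rule integral_mono)
    show "integrable lborel (\<lambda>x. W x * lap (\<lambda>x. \<phi> x * \<phi> x) x)"
      by (rule integrable_compact_support[OF _ K(1)])
         (intro continuous_on_mult continuous_on_lap sm2 smooth_continuous W, simp add: lap0)
    show "integrable lborel (\<lambda>x. A * (indicator (ball 0 1) x * g x))" using int by (rule integrable_mult_right)
    fix x
    show "W x * lap (\<lambda>x. \<phi> x * \<phi> x) x \<le> A * (indicator (ball 0 1) x * g x)"
    proof (cases "x \<in> K")
      case True
      have "W x * lap (\<lambda>x. \<phi> x * \<phi> x) x \<le> \<bar>W x\<bar> * \<bar>lap (\<lambda>x. \<phi> x * \<phi> x) x\<bar>"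
        using abs_ge_self[of "W x * lap (\<lambda>x. \<phi> x * \<phi> x) x"] unfolding abs_mult .
      also have "\<dots> \<le> g x * A"
      proof (rule mult_mono)
        show "\<bar>W x\<bar> \<le> g x" using g(2)[of x] exp_ge_add_one_self[of "- g x"] by (simp add: W_def)
      qed (use A g(2) in auto)
      finally show ?thesis using True K(2) by (simp add: subset_iff mult.commute)
    qed (use lap0 A(1) g(2) in \<open>auto simp: indicator_def\<close>)
  qed
  also have "\<dots> = A * (LINT x|lborel. indicator (ball 0 1) x * g x)" by (rule integral_mult_right_zero)
  finally show ?thesis .
qed

text \<open>All properties pass termwise from the kernels through nonnegative weights. The constant
  4 is the mass bound 3 times the 4/3 of \<open>integral_kern_ball_le\<close>.\<close>

lemma exists_superharmonic_cover:
  fixes F :: "'a::euclidean_space set"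
  assumes n: "DIM('a) \<ge> 2" and F: "compact F" "F \<subseteq> ball 0 1" and M: "M > 0"
    and en: "\<And>\<nu> :: 'a measure. prob_space \<nu> \<Longrightarrow> sets \<nu> = sets borel \<Longrightarrow> emeasure \<nu> (- F) = 0 \<Longrightarrow> energy \<nu> > ennreal M"
  obtains g :: "'a \<Rightarrow> real" where "smooth g" "\<And>x. 0 \<le> g x" "\<And>x. lap g x \<le> 0" "\<And>x. x \<in> F \<Longrightarrow> 1 < g x"
    "integrable lborel (\<lambda>x. indicator (ball 0 1) x * g x)"
    "(LINT x|lborel. indicator (ball 0 1) x * g x) \<le> 4 * measure lborel (ball (0::'a) 2) / M"
proof -
  obtain d S w where d: "d > 0" and S: "finite S" "S \<subseteq> F" "\<And>a. a \<in> S \<Longrightarrow> 0 \<le> w a" "sum w S \<le> 3 / M"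
    and big: "\<And>p. p \<in> F \<Longrightarrow> 1 < (\<Sum>a\<in>S. w a * kern d (p - a))"
    using exists_small_potential[OF n F(1) M en] by blast
  define g where "g x = (\<Sum>a\<in>S. w a * kern d (x - a))" for x
  have "smooth g" unfolding g_def by (rule smooth_linear_combination) (rule smooth_kern[OF d])
  moreover have "0 \<le> g x" for x unfolding g_def using S(3) by (intro sum_nonneg mult_nonneg_nonneg) auto
  moreover have "lap g x \<le> 0" for x
  proof -
    have "lap g x = (\<Sum>a\<in>S. w a * lap (\<lambda>x. kern d (x - a)) x)"
      unfolding g_def by (rule lap_linear_combination) (rule smooth_kern[OF d])
    also have "\<dots> \<le> 0" using S(3) lap_kern_nonpos[OF d n] by (intro sum_nonpos mult_nonneg_nonpos) auto
    finally show ?thesis .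
  qed
  moreover have "1 < g x" if "x \<in> F" for x using big[OF that] by (simp add: g_def)
  moreover have gi: "(\<lambda>x. indicator (ball 0 1) x * g x) = (\<lambda>x. \<Sum>a\<in>S. w a * (indicator (ball 0 1) x * kern d (x - a)))"
    by (auto simp: g_def sum_distrib_left ac_simps)
  moreover have ik: "integrable lborel (\<lambda>x. w a * (indicator (ball 0 1) x * kern d (x - a)))" for a
    by (rule integrable_mult_right) (rule integrable_kern_ball[OF d])
  then have "integrable lborel (\<lambda>x. indicator (ball 0 1) x * g x)"
    unfolding gi by (intro Bochner_Integration.integrable_sum)
  moreover have "(LINT x|lborel. indicator (ball 0 1) x * g x) \<le> 4 * measure lborel (ball (0::'a) 2) / M"
  proof -
    let ?V = "measure lborel (ball (0::'a) 2)"
    have "(LINT x|lborel. indicator (ball 0 1) x * g x) =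
        (\<Sum>a\<in>S. w a * (LINT x|lborel. indicator (ball 0 1) x * kern d (x - a)))"
      unfolding gi by (subst Bochner_Integration.integral_sum) (use ik in auto)
    also have "\<dots> \<le> (\<Sum>a\<in>S. w a * (4/3 * ?V))"
      using S(2,3) F(2) by (intro sum_mono mult_left_mono integral_kern_ball_le[OF d n]) auto
    also have "\<dots> = sum w S * (4/3 * ?V)" by (rule sum_distrib_right[symmetric])
    also have "\<dots> \<le> 3 / M * (4/3 * ?V)" using S(4) by (intro mult_right_mono) auto
    also have "\<dots> = 4 * ?V / M" by simp
    finally show ?thesis .
  qed
  ultimately show thesis using that by blast
qed

text \<open>For the product v of \<phi> and the cutoff of \<open>g\<close>, the loss \<phi> - v and
  the part of the gradient containing grad g both have squared L2 norm at most \<open>C / M\<close>;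
  the other part of the gradient is pointwise at most grad \<phi>. The triangle inequality then
  gives the two bounds. \<open>C\<close> is chosen before \<open>F\<close> and
  \<open>M\<close>.\<close>

lemma cut_test_function:
  fixes \<phi> :: "'a::euclidean_space \<Rightarrow> real"
  assumes n: "DIM('a) \<ge> 2" and \<phi>: "smooth \<phi>" and K: "compact K" "K \<subseteq> ball 0 1" "\<And>x. x \<notin> K \<Longrightarrow> \<phi> x = 0"
  obtains C where "C \<ge> 0"
    "\<And>F M. compact F \<Longrightarrow> F \<subseteq> ball 0 1 \<Longrightarrow> M > 0 \<Longrightarrow>
      (\<And>\<nu> :: 'a measure. prob_space \<nu> \<Longrightarrow> sets \<nu> = sets borel \<Longrightarrow> emeasure \<nu> (- F) = 0 \<Longrightarrow> energy \<nu> > ennreal M) \<Longrightarrow>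
      \<exists>v \<in> test_functions (K - F). sqrt (sqint \<phi>) \<le> sqrt (sqint v) + sqrt (C / M) \<and>
         sqrt (dirichlet v) \<le> sqrt (dirichlet \<phi>) + sqrt (C / M)"
proof -
  obtain L where L: "L \<ge> 0" "\<And>t. t \<ge> 0 \<Longrightarrow> \<bar>flat ((pderiv 1 - 1) * [:0, 0, 1:]) t\<bar> \<le> L"
    "\<And>t. t \<ge> 0 \<Longrightarrow> 1 - flat 1 t \<le> L * t"
    using flat_1_lipschitz by blast
  define \<eta> \<eta>' where "\<eta> = flat 1" and "\<eta>' = flat ((pderiv 1 - 1) * [:0, 0, 1:])"
  have d\<eta>: "(\<eta> has_real_derivative \<eta>' t) (at t)" for t unfolding \<eta>_def \<eta>'_def by (rule flat_has_derivative)
  have \<eta>01: "0 \<le> \<eta> t" "\<eta> t \<le> 1" if "t \<ge> 0" for t using flat_1[OF that] by (simp_all add: \<eta>_def)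
  have \<eta>0: "\<eta> t = 0" "\<eta>' t = 0" if "t \<ge> 1" for t using that by (simp_all add: \<eta>_def \<eta>'_def flat_def)
  have \<eta>L: "\<bar>\<eta>' t\<bar> \<le> L" "1 - \<eta> t \<le> L * t" if "t \<ge> 0" for t using L(2,3)[OF that] by (simp_all add: \<eta>_def \<eta>'_def)
  obtain B where B: "0 \<le> B" "\<And>x. norm (\<phi> x) \<le> B"
    using bounded_compact_support[OF smooth_continuous[OF \<phi>] K(1,3)] by blast
  have sm2: "smooth (\<lambda>x. \<phi> x * \<phi> x)" using C_k_mult \<phi> by blast
  have lap0: "lap (\<lambda>x. \<phi> x * \<phi> x) x = 0" if "x \<notin> K" for x
    by (rule lap_eq_0_outside[OF K(1) _ that]) (simp add: K(3))
  obtain A where A: "0 \<le> A" "\<And>x. norm (lap (\<lambda>x. \<phi> x * \<phi> x) x) \<le> A"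
    using bounded_compact_support[OF continuous_on_lap[OF sm2] K(1) lap0] by blast
  define V where "V = 4 * measure lborel (ball (0::'a) 2)"
  \<comment> \<open>The first summand serves \<phi> - v, the second the gradient part
    \<open>q\<close>; \<open>V / M\<close> bounds the integral of \<open>g\<close>.\<close>
  define C where "C = (B\<^sup>2 * L + L\<^sup>2 * exp 1 * A) * V"
  have V: "V \<ge> 0" by (simp add: V_def)
  have C: "C \<ge> 0" using V A B L by (simp add: C_def)
  show thesis
  proof (rule that[OF C])
    fix F :: "'a set" and M :: real
    assume F: "compact F" "F \<subseteq> ball 0 1" and M: "M > 0"
      and en: "\<And>\<nu> :: 'a measure. prob_space \<nu> \<Longrightarrow> sets \<nu> = sets borel \<Longrightarrow> emeasure \<nu> (- F) = 0 \<Longrightarrow> energy \<nu> > ennreal M"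
    obtain g :: "'a \<Rightarrow> real" where g: "smooth g" "\<And>x. 0 \<le> g x" "\<And>x. lap g x \<le> 0" "\<And>x. x \<in> F \<Longrightarrow> 1 < g x"
      and gi: "integrable lborel (\<lambda>x. indicator (ball 0 1) x * g x)"
        "(LINT x|lborel. indicator (ball 0 1) x * g x) \<le> 4 * measure lborel (ball (0::'a) 2) / M"
      using exists_superharmonic_cover[OF n F M en] by blast
    define I where "I = (LINT x|lborel. indicator (ball 0 1) x * g x)"
    have I: "I \<le> V / M" using gi(2) by (simp add: I_def V_def)
    define v where "v x = \<phi> x * \<eta> (g x)" for x
    have s\<eta>: "smooth (\<lambda>x. \<eta> (g x))" unfolding \<eta>_def using smooth_flat[OF g(1)] .
    have s\<eta>': "smooth (\<lambda>x. \<eta>' (g x))" unfolding \<eta>'_def using smooth_flat[OF g(1)] .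
    have sv: "smooth v" unfolding v_def using C_k_mult \<phi> s\<eta> by blast
    \<comment> \<open>The cutoff vanishes where g > 1. Since \<open>g\<close> is strictly above 1 on
      \<open>F\<close>, this closed condition keeps the support away from \<open>F\<close>.\<close>
    define K' where "K' = K \<inter> {x. g x \<le> 1}"
    have "closed {x. g x \<le> 1}"
      by (rule closed_Collect_le) (auto intro: smooth_continuous[OF g(1)])
    then have K': "compact K'" unfolding K'_def using K(1) by (rule compact_Int_closed[rotated])
    have v0: "v x = 0" if "x \<notin> K'" for x
      using that K(3)[of x] \<eta>0(1)[of "g x"] by (cases "x \<in> K") (auto simp: v_def K'_def)
    have "K' \<subseteq> K - F" using g(4) by (force simp: K'_def)
    then have vt: "v \<in> test_functions (K - F)" using test_functionsI[OF sv K' _ v0] by blast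
    have 1: "(LINT x|lborel. (norm (\<phi> x - v x))\<^sup>2) \<le> C / M"
    proof -
      have "(LINT x|lborel. (norm (\<phi> x - v x))\<^sup>2) \<le> (LINT x|lborel. B\<^sup>2 * L * (indicator (ball 0 1) x * g x))"
      proof (rule integral_mono)
        show "integrable lborel (\<lambda>x. (norm (\<phi> x - v x))\<^sup>2)"
          by (rule integrable_compact_support[OF _ K(1)])
             (intro continuous_on_power continuous_on_norm continuous_on_diff smooth_continuous \<phi> sv, simp add: K v_def)
        show "integrable lborel (\<lambda>x. B\<^sup>2 * L * (indicator (ball 0 1) x * g x))" using gi(1) by (rule integrable_mult_right)
        fix x
        show "(norm (\<phi> x - v x))\<^sup>2 \<le> B\<^sup>2 * L * (indicator (ball 0 1) x * g x)"
        proof (cases "x \<in> K")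
          case True
          have "\<phi> x - v x = \<phi> x * (1 - \<eta> (g x))" by (simp add: v_def algebra_simps)
          then have "(norm (\<phi> x - v x))\<^sup>2 = (\<phi> x)\<^sup>2 * (1 - \<eta> (g x))\<^sup>2" by (simp add: power_mult_distrib)
          also have "\<dots> \<le> B\<^sup>2 * (L * g x)"
          proof (rule mult_mono)
            show "(\<phi> x)\<^sup>2 \<le> B\<^sup>2" using power_mono[OF B(2)[of x], of 2] by simp
            \<comment> \<open>One factor is given away because only the integral of
              \<open>g\<close>, not of its square, is controlled.\<close>
            have "(1 - \<eta> (g x))\<^sup>2 \<le> (1 - \<eta> (g x)) * 1"
              unfolding power2_eq_square using \<eta>01[OF g(2)[of x]] by (intro mult_left_mono) auto
            then show "(1 - \<eta> (g x))\<^sup>2 \<le> L * g x" using \<eta>L(2)[OF g(2)[of x]] by simp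
          qed auto
          finally show ?thesis using True K(2) by (simp add: subset_iff mult.assoc)
        qed (use K(3) L(1) g(2) in \<open>simp add: v_def\<close>)
      qed
      also have "\<dots> = B\<^sup>2 * L * I" unfolding I_def by (rule integral_mult_right_zero)
      also have "\<dots> \<le> B\<^sup>2 * L * (V / M)" using I B(1) L(1) by (intro mult_left_mono) auto
      also have "\<dots> \<le> C / M"
        unfolding C_def using V A(1) M by (simp add: divide_right_mono distrib_right)
      finally show ?thesis .
    qed
    define p q where "p x = \<eta> (g x) *\<^sub>R gradient \<phi> x" and "q x = (\<phi> x * \<eta>' (g x)) *\<^sub>R gradient g x" for x
    have grad: "gradient v x = p x + q x" for x
    proof -
      have "dd v b x = \<phi> x * (\<eta>' (g x) * dd g b x) + dd \<phi> b x * \<eta> (g x)" for b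
        unfolding v_def dd_mult[OF \<phi> s\<eta>] dd_compose[OF d\<eta> g(1)] by simp
      then show ?thesis
        by (simp add: gradient_def p_def q_def scaleR_sum_right sum.distrib[symmetric] algebra_simps)
    qed
    have cp: "continuous_on UNIV p" "continuous_on UNIV q"
      unfolding p_def q_def
      by (intro continuous_on_scaleR continuous_on_mult gradient_continuous \<phi> g(1) smooth_continuous s\<eta> s\<eta>')+
    have gr0: "gradient \<phi> x = 0" if "x \<notin> K" for x using gradient_eq_0_outside[of K \<phi>, OF K(1,3) that] by blast
    have ip: "integrable lborel (\<lambda>x. (norm (p x))\<^sup>2)"
      by (rule integrable_compact_support[OF _ K(1)])
         (intro continuous_on_power continuous_on_norm cp, simp add: p_def gr0)
    have iq: "integrable lborel (\<lambda>x. (norm (q x))\<^sup>2)"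
      by (rule integrable_compact_support[OF _ K(1)])
         (intro continuous_on_power continuous_on_norm cp, simp add: q_def K)
    have mp: "p \<in> borel_measurable lborel" "q \<in> borel_measurable lborel"
      using cp borel_measurable_continuous_onI by auto
    have i\<phi>: "integrable lborel (\<lambda>x. (norm (gradient \<phi> x))\<^sup>2)"
      by (rule integrable_compact_support[OF _ K(1)])
         (intro continuous_on_power continuous_on_norm gradient_continuous \<phi>, simp add: gr0)
    have 2: "(LINT x|lborel. (norm (p x))\<^sup>2) \<le> dirichlet \<phi>"
      unfolding dirichlet_def
    proof (rule integral_mono[OF ip i\<phi>])
      fix x
      have "norm (p x) \<le> 1 * norm (gradient \<phi> x)"
        unfolding p_def norm_scaleR using \<eta>01[OF g(2)[of x]] by (intro mult_right_mono) auto
      then show "(norm (p x))\<^sup>2 \<le> (norm (gradient \<phi> x))\<^sup>2" by (intro power_mono) auto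
    qed
    have 3: "(LINT x|lborel. (norm (q x))\<^sup>2) \<le> C / M"
    proof -
      let ?e = "\<lambda>x. (\<phi> x)\<^sup>2 * (exp (- g x) * (norm (gradient g x))\<^sup>2)"
      have "(LINT x|lborel. (norm (q x))\<^sup>2) \<le> (LINT x|lborel. L\<^sup>2 * exp 1 * ?e x)"
      proof (rule integral_mono[OF iq])
        have "integrable lborel ?e"
          by (rule integrable_compact_support[OF _ K(1)])
            (intro continuous_on_mult continuous_on_power continuous_on_exp continuous_on_minus
            continuous_on_norm gradient_continuous smooth_continuous \<phi> g(1), simp add: K)
        then show "integrable lborel (\<lambda>x. L\<^sup>2 * exp 1 * ?e x)" by (rule integrable_mult_right)
        fix x
        \<comment> \<open>\<eta>' vanishes from 1 on, and below 1 the product of the two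
          exponentials is at least 1. This brings in the weight of
          \<open>superharmonic_energy_le\<close> at the cost of a factor e.\<close>
        have "(\<eta>' (g x))\<^sup>2 \<le> L\<^sup>2 * (exp 1 * exp (- g x))"
        proof (cases "g x < 1")
          case True
          have "(\<eta>' (g x))\<^sup>2 \<le> L\<^sup>2" using power_mono[OF \<eta>L(1)[OF g(2)[of x]], of 2] by simp
          also have "L\<^sup>2 * 1 \<le> L\<^sup>2 * (exp 1 * exp (- g x))"
            using True by (intro mult_left_mono) (simp_all add: exp_add[symmetric])
          finally show ?thesis by simp
        qed (simp add: \<eta>0)
        then have "(\<phi> x)\<^sup>2 * (norm (gradient g x))\<^sup>2 * (\<eta>' (g x))\<^sup>2 \<le>
            (\<phi> x)\<^sup>2 * (norm (gradient g x))\<^sup>2 * (L\<^sup>2 * (exp 1 * exp (- g x)))"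
          by (intro mult_left_mono) auto
        then show "(norm (q x))\<^sup>2 \<le> L\<^sup>2 * exp 1 * ?e x"
          by (simp add: q_def power_mult_distrib ac_simps)
      qed
      also have "\<dots> = L\<^sup>2 * exp 1 * (LINT x|lborel. ?e x)" by (rule integral_mult_right_zero)
      also have "\<dots> \<le> L\<^sup>2 * exp 1 * (A * I)"
        unfolding I_def
        by (intro mult_left_mono superharmonic_energy_le[OF \<phi> K g(1,2,3) A(1) _ gi(1)]) (use A(2) in auto)
      also have "\<dots> \<le> L\<^sup>2 * exp 1 * (A * (V / M))" using I A(1) by (intro mult_left_mono) auto
      also have "\<dots> \<le> C / M"
        unfolding C_def using V B(1) L(1) M by (simp add: divide_right_mono distrib_right)
      finally show ?thesis .
    qed
    have "sqrt (dirichlet v) \<le> sqrt (LINT x|lborel. (norm (p x))\<^sup>2) + sqrt (LINT x|lborel. (norm (q x))\<^sup>2)"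
      unfolding dirichlet_def grad by (rule L2_triangle(2)[OF mp ip iq])
    also have "\<dots> \<le> sqrt (dirichlet \<phi>) + sqrt (C / M)" using 2 3 by (intro add_mono) auto
    finally have dir: "sqrt (dirichlet v) \<le> sqrt (dirichlet \<phi>) + sqrt (C / M)" .
    have iv: "integrable lborel (\<lambda>x. (norm (v x))\<^sup>2)" using test_function_integrable(1)[OF vt] by simp
    have id: "integrable lborel (\<lambda>x. (norm (\<phi> x - v x))\<^sup>2)"
      by (rule integrable_compact_support[OF _ K(1)])
        (intro continuous_on_power continuous_on_norm continuous_on_diff smooth_continuous \<phi> sv, simp add: K v_def)
    have mv: "v \<in> borel_measurable lborel" "(\<lambda>x. \<phi> x - v x) \<in> borel_measurable lborel"
      using smooth_measurable[OF sv] smooth_measurable[OF \<phi>] by auto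
    have "sqrt (sqint \<phi>) \<le> sqrt (sqint v) + sqrt (LINT x|lborel. (norm (\<phi> x - v x))\<^sup>2)"
      using L2_triangle(2)[OF mv iv id] by (simp add: sqint_def)
    also have "\<dots> \<le> sqrt (sqint v) + sqrt (C / M)" using 1 by simp
    finally show "\<exists>v \<in> test_functions (K - F). sqrt (sqint \<phi>) \<le> sqrt (sqint v) + sqrt (C / M) \<and>
         sqrt (dirichlet v) \<le> sqrt (dirichlet \<phi>) + sqrt (C / M)" using vt dir by blast
  qed
qed

section \<open>Scaling and the comparison of eigenvalues\<close>

text \<open>Transport by z -> x + r z: volumes gain \<open>r^n\<close> and gradients lose a factor
  r, so the Rayleigh quotient is divided by \<open>r^2\<close>.\<close>

lemma test_function_affine:
  fixes v :: "'a::euclidean_space \<Rightarrow> real"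
  assumes v: "v \<in> test_functions S" and r: "r > 0" and S: "\<And>z. z \<in> S \<Longrightarrow> x + r *\<^sub>R z \<in> D"
  obtains u where "u \<in> test_functions D" "sqint u = r ^ DIM('a) * sqint v"
    "dirichlet u = r ^ DIM('a) * (dirichlet v / r\<^sup>2)"
proof -
  obtain K where K: "smooth v" "compact K" "K \<subseteq> S" "\<And>x. x \<notin> K \<Longrightarrow> v x = 0"
    using v by (elim test_functionsE) auto
  define a where "a = - ((1 / r) *\<^sub>R x)"
  define u where "u y = v ((1 / r) *\<^sub>R y + a)" for y
  have inv: "(1 / r) *\<^sub>R (x + r *\<^sub>R z) + a = z" for z
    using r by (simp add: a_def scaleR_add_right)
  have inv': "x + r *\<^sub>R ((1 / r) *\<^sub>R y + a) = y" for y
    using r by (simp add: a_def scaleR_diff_right)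
  have su: "smooth u" unfolding u_def using K(1) C_k_affine by blast
  have "u \<in> test_functions D"
  proof (rule test_functionsI[OF su])
    show "compact ((\<lambda>z. x + r *\<^sub>R z) ` K)"
      by (rule compact_continuous_image[OF _ K(2)]) (intro continuous_intros)
    show "(\<lambda>z. x + r *\<^sub>R z) ` K \<subseteq> D" using K(3) S by blast
    fix y assume y: "y \<notin> (\<lambda>z. x + r *\<^sub>R z) ` K"
    have "(1 / r) *\<^sub>R y + a \<notin> K"
    proof
      assume "(1 / r) *\<^sub>R y + a \<in> K"
      then have "x + r *\<^sub>R ((1 / r) *\<^sub>R y + a) \<in> (\<lambda>z. x + r *\<^sub>R z) ` K" by (rule imageI)
      then show False using y by (simp only: inv')
    qed
    then show "u y = 0" by (simp add: u_def K)
  qed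
  moreover have "sqint u = r ^ DIM('a) * sqint v"
  proof -
    have "(LINT y|lborel. (u y)\<^sup>2) = \<bar>r\<bar> ^ DIM('a) *\<^sub>R (LINT z|lborel. (u (x + r *\<^sub>R z))\<^sup>2)"
      by (rule lborel_integral_affine) (use r smooth_measurable[OF su] in auto)
    then show ?thesis using r by (simp add: sqint_def u_def inv)
  qed
  moreover have "dirichlet u = r ^ DIM('a) * (dirichlet v / r\<^sup>2)"
  proof -
    have "gradient u y = (1 / r) *\<^sub>R gradient v ((1 / r) *\<^sub>R y + a)" for y
      unfolding gradient_def u_def dd_affine[OF K(1)] by (simp add: scaleR_sum_right)
    then have "gradient u (x + r *\<^sub>R z) = (1 / r) *\<^sub>R gradient v z" for z by (simp only: inv)
    then have 1: "(norm (gradient u (x + r *\<^sub>R z)))\<^sup>2 = (norm (gradient v z))\<^sup>2 / r\<^sup>2" for z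
      using r by (simp add: power_divide)
    have "(LINT y|lborel. (norm (gradient u y))\<^sup>2) =
        \<bar>r\<bar> ^ DIM('a) *\<^sub>R (LINT z|lborel. (norm (gradient u (x + r *\<^sub>R z)))\<^sup>2)"
      by (rule lborel_integral_affine) (use r gradient_measurable[OF su] in auto)
    then show ?thesis unfolding 1 using r by (simp add: dirichlet_def)
  qed
  ultimately show thesis using that by blast
qed

text \<open>The kernel is homogeneous of degree 2 - n.\<close>

lemma energy_affine:
  fixes \<nu> :: "'a::euclidean_space measure"
  assumes \<nu>: "prob_space \<nu>" "sets \<nu> = sets borel" and r: "r > 0"
  shows "energy (distr \<nu> borel (\<lambda>z. x + r *\<^sub>R z)) = inverse (ennreal (r ^ (DIM('a) - 2))) * energy \<nu>"
proof -
  interpret prob_space \<nu> by (rule \<nu>)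
  note [measurable_cong] = \<nu>(2)
  have T[measurable]: "(\<lambda>z. x + r *\<^sub>R z) \<in> measurable \<nu> borel" by measurable
  interpret \<mu>: prob_space "distr \<nu> borel (\<lambda>z. x + r *\<^sub>R z)" by (rule prob_space_distr[OF T])
  have k: "newton_kernel (x + r *\<^sub>R y) (x + r *\<^sub>R z) = inverse (ennreal (r ^ (DIM('a) - 2))) * newton_kernel y z" for y z
  proof -
    have "x + r *\<^sub>R y - (x + r *\<^sub>R z) = r *\<^sub>R (y - z)" by (simp add: scaleR_diff_right)
    then have "ennreal (norm (x + r *\<^sub>R y - (x + r *\<^sub>R z))) ^ (DIM('a) - 2) =
        ennreal (r ^ (DIM('a) - 2)) * ennreal (norm (y - z)) ^ (DIM('a) - 2)"
      using r by (simp add: ennreal_power ennreal_mult[symmetric] power_mult_distrib)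
    then show ?thesis
      unfolding newton_kernel_def using r by (subst ennreal_inverse_mult[symmetric]) (auto simp: ennreal_power)
  qed
  have "energy (distr \<nu> borel (\<lambda>z. x + r *\<^sub>R z)) =
      (\<integral>\<^sup>+y. (\<integral>\<^sup>+z. newton_kernel (x + r *\<^sub>R y) (x + r *\<^sub>R z) \<partial>\<nu>) \<partial>\<nu>)"
    unfolding energy_def by (subst nn_integral_distr nn_integral_distr; measurable)+
  also have "\<dots> = inverse (ennreal (r ^ (DIM('a) - 2))) * energy \<nu>"
    unfolding k energy_def by (simp add: nn_integral_cmult)
  finally show ?thesis .
qed

text \<open>A probability on \<open>F\<close> with energy at most \<open>M\<close>, pushed forward
  by z -> x + r z, would be supported in a compact subset of \<open>E\<close> with energy at most
  \<open>M / r^(n - 2)\<close>, forcing the capacity of \<open>E\<close> up to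
  \<open>r^(n - 2) / M\<close>.\<close>

lemma energy_gt_of_cap_lt:
  fixes \<nu> :: "'a::euclidean_space measure"
  assumes \<nu>: "prob_space \<nu>" "sets \<nu> = sets borel" "emeasure \<nu> (- F) = 0" and r: "r > 0" and M: "M > 0"
    and F: "compact F" "(\<lambda>z. x + r *\<^sub>R z) ` F \<subseteq> E" and cap: "cap E < ennreal (r ^ (DIM('a) - 2) / M)"
  shows "energy \<nu> > ennreal M"
proof (rule ccontr)
  assume "\<not> energy \<nu> > ennreal M"
  then have le: "energy \<nu> \<le> ennreal M" by simp
  define T where "T z = x + r *\<^sub>R z" for z
  define R where "R = r ^ (DIM('a) - 2)"
  define \<mu> where "\<mu> = distr \<nu> borel T"
  have R: "R > 0" using r by (simp add: R_def)
  interpret prob_space \<nu> by (rule \<nu>)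
  note [measurable_cong] = \<nu>(2)
  have T[measurable]: "T \<in> measurable \<nu> borel" unfolding T_def by measurable
  have TF: "compact (T ` F)" unfolding T_def by (rule compact_continuous_image[OF _ F(1)]) (intro continuous_intros)
  have injT: "inj T" using r by (auto simp: T_def inj_def)
  have "measure_support \<mu> \<subseteq> T ` F"
  proof
    fix y assume y: "y \<in> measure_support \<mu>"
    show "y \<in> T ` F"
    proof (rule ccontr)
      assume "y \<notin> T ` F"
      then have "emeasure \<mu> (- (T ` F)) > 0"
        using y compact_imp_closed[OF TF] by (auto simp: measure_support_def open_Compl)
      moreover have "emeasure \<mu> (- (T ` F)) = emeasure \<nu> (T -` (- (T ` F)) \<inter> space \<nu>)"
        unfolding \<mu>_def by (rule emeasure_distr[OF T]) (use compact_imp_closed[OF TF] in auto)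
      moreover have "\<dots> \<le> emeasure \<nu> (- F)"
        by (rule emeasure_mono) (use compact_imp_closed[OF F(1)] \<nu>(2) in auto)
      ultimately show False using \<nu>(3) by simp
    qed
  qed
  moreover have "prob_space \<mu>" unfolding \<mu>_def by (rule prob_space_distr[OF T])
  ultimately have \<mu>: "\<mu> \<in> prob_measures_on (T ` F)" by (simp add: prob_measures_on_def \<mu>_def)
  have "energy \<mu> = inverse (ennreal R) * energy \<nu>"
    unfolding \<mu>_def T_def R_def by (rule energy_affine[OF \<nu>(1,2) r])
  also have "\<dots> \<le> inverse (ennreal R) * ennreal M" using le by (rule mult_left_mono) simp
  also have "\<dots> = ennreal (M / R)"
    using R M by (simp add: inverse_ennreal ennreal_mult[symmetric] field_simps)
  finally have e: "energy \<mu> \<le> ennreal (M / R)" .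
  \<comment> \<open>Energy 0 causes no trouble, since 1 / 0 is \<infinity> in
    \<open>ennreal\<close>; infinite energy is excluded by \<open>e\<close>.\<close>
  have "ennreal (R / M) \<le> 1 / energy \<mu>"
  proof (cases "energy \<mu>" rule: ennreal_cases)
    case (real t)
    show ?thesis
    proof (cases "t = 0")
      case False
      then have t: "t > 0" using real by simp
      have "t \<le> M / R" using e real R M by (simp add: ennreal_le_iff)
      then have "R / M \<le> 1 / t" using t R M by (simp add: field_simps)
      then show ?thesis using real t by (simp add: divide_ennreal ennreal_leI flip: ennreal_1)
    qed (simp add: real)
  qed (use e in \<open>simp add: top_unique\<close>)
  also have "1 / energy \<mu> \<le> cap_compact (T ` F)"
  proof -
    have "energy \<mu> \<noteq> \<infinity>" using e by (auto simp: top_unique)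
    then show ?thesis using \<mu> by (auto simp: cap_compact_def intro: SUP_upper)
  qed
  also have "\<dots> \<le> cap E"
    unfolding cap_def using TF F(2) by (intro SUP_upper) (auto simp: T_def)
  finally show False using cap by (simp add: R_def leD)
qed

text \<open>For fixed \<phi> and each M, a centre x with capacity below
  \<open>r^(n - 2) / (M + 1)\<close> yields a test function on \<open>D\<close> whose rescaled
  quotient exceeds that of \<phi> only by terms in \<open>s M\<close>, which tends to 0. The centre
  may change with M; the constant \<open>C\<close> does not.\<close>

lemma lambda1_scale_le:
  fixes D :: "'a::euclidean_space set"
  assumes n: "DIM('a) \<ge> 2" and D: "open D" and r: "r > 0"
    and cap: "\<And>\<epsilon>. \<epsilon> > 0 \<Longrightarrow> \<exists>x\<in>D. cap (ball x r \<inter> - D) < ennreal \<epsilon>"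
  shows "\<lambda>\<^sub>1 D * ennreal (r\<^sup>2) \<le> \<lambda>\<^sub>1 (ball (0::'a) 1)"
proof (rule le_lambda1)
  fix \<phi> :: "'a \<Rightarrow> real" assume \<phi>: "\<phi> \<in> test_functions (ball 0 1)" and pos: "sqint \<phi> > 0"
  obtain K where K: "smooth \<phi>" "compact K" "K \<subseteq> ball 0 1" "\<And>x. x \<notin> K \<Longrightarrow> \<phi> x = 0"
    using \<phi> by (elim test_functionsE) auto
  obtain C where C: "C \<ge> 0" and cut: "\<And>F M. compact F \<Longrightarrow> F \<subseteq> ball 0 1 \<Longrightarrow> M > 0 \<Longrightarrow>
      (\<And>\<nu> :: 'a measure. prob_space \<nu> \<Longrightarrow> sets \<nu> = sets borel \<Longrightarrow> emeasure \<nu> (- F) = 0 \<Longrightarrow> energy \<nu> > ennreal M) \<Longrightarrow>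
      \<exists>v \<in> test_functions (K - F). sqrt (sqint \<phi>) \<le> sqrt (sqint v) + sqrt (C / M) \<and>
         sqrt (dirichlet v) \<le> sqrt (dirichlet \<phi>) + sqrt (C / M)"
    using cut_test_function[OF n K] by blast
  define s where "s M = sqrt (C / real (Suc M))" for M
  \<comment> \<open>The restriction on \<open>s M\<close> keeps the lower bound for
    \<open>sqrt (sqint v)\<close> positive, so that it may be squared and divided by; it holds for
    all large M.\<close>
  have bound: "\<lambda>\<^sub>1 D * ennreal (r\<^sup>2) \<le> ennreal ((sqrt (dirichlet \<phi>) + s M)\<^sup>2 / (sqrt (sqint \<phi>) - s M)\<^sup>2)"
    if sM: "s M < sqrt (sqint \<phi>)" for M
  proof -
    define R where "R = r ^ (DIM('a) - 2)"
    obtain x where x: "x \<in> D" "cap (ball x r \<inter> - D) < ennreal (R / real (Suc M))"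
      using cap[of "R / real (Suc M)"] r by (auto simp: R_def)
    define T where "T z = x + r *\<^sub>R z" for z
    \<comment> \<open>Intersecting with the support \<open>K\<close> gives compactness, and T maps
      what remains of \<open>K\<close> into \<open>D\<close>.\<close>
    define F where "F = K \<inter> T -` (- D)"
    have "closed (T -` (- D))"
      unfolding T_def by (rule closed_vimage) (use D in \<open>auto intro!: continuous_intros\<close>)
    then have F: "compact F" unfolding F_def using K(2) by (rule compact_Int_closed[rotated])
    have FE: "(\<lambda>z. x + r *\<^sub>R z) ` F \<subseteq> ball x r \<inter> - D"
    proof
      fix y assume "y \<in> (\<lambda>z. x + r *\<^sub>R z) ` F"
      then obtain z where z: "z \<in> F" "y = x + r *\<^sub>R z" by blast
      then have "norm z < 1" using K(3) by (auto simp: F_def)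
      then have "r * norm z < r" using r by simp
      then show "y \<in> ball x r \<inter> - D" using z r by (auto simp: dist_norm F_def T_def)
    qed
    have "\<exists>v \<in> test_functions (K - F). sqrt (sqint \<phi>) \<le> sqrt (sqint v) + sqrt (C / real (Suc M)) \<and>
         sqrt (dirichlet v) \<le> sqrt (dirichlet \<phi>) + sqrt (C / real (Suc M))"
    proof (rule cut[OF F])
      show "F \<subseteq> ball 0 1" using K(3) by (auto simp: F_def)
      show "energy \<nu> > ennreal (real (Suc M))"
        if "prob_space \<nu>" "sets \<nu> = sets borel" "emeasure \<nu> (- F) = 0" for \<nu> :: "'a measure"
        by (rule energy_gt_of_cap_lt[OF that r _ F FE]) (use x in \<open>auto simp: R_def\<close>)
    qed simp
    then obtain v where v: "v \<in> test_functions (K - F)" and v1: "sqrt (sqint \<phi>) \<le> sqrt (sqint v) + s M"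
      and v2: "sqrt (dirichlet v) \<le> sqrt (dirichlet \<phi>) + s M"
      unfolding s_def by blast
    obtain u where u: "u \<in> test_functions D" "sqint u = r ^ DIM('a) * sqint v"
      "dirichlet u = r ^ DIM('a) * (dirichlet v / r\<^sup>2)"
      by (rule test_function_affine[OF v r, of x D]) (auto simp: F_def T_def)
    have nn: "sqint v \<ge> 0" "dirichlet v \<ge> 0" by (simp_all add: sqint_def dirichlet_def)
    have sv: "0 < sqrt (sqint \<phi>) - s M" "sqrt (sqint \<phi>) - s M \<le> sqrt (sqint v)" using sM v1 by auto
    then have "sqrt (sqint v) > 0" by linarith
    then have vpos: "sqint v > 0" by simp
    then have "\<lambda>\<^sub>1 D \<le> ennreal (dirichlet u / sqint u)"
      using r by (intro lambda1_le[OF D u(1)]) (simp add: u(2))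
    also have "dirichlet u / sqint u = dirichlet v / sqint v / r\<^sup>2" using r by (simp add: u field_simps)
    finally have "\<lambda>\<^sub>1 D * ennreal (r\<^sup>2) \<le> ennreal (dirichlet v / sqint v / r\<^sup>2) * ennreal (r\<^sup>2)"
      by (rule mult_right_mono) simp
    also have "\<dots> = ennreal (dirichlet v / sqint v)"
      using r nn by (subst ennreal_mult[symmetric]) auto
    also have "dirichlet v / sqint v \<le> (sqrt (dirichlet \<phi>) + s M)\<^sup>2 / (sqrt (sqint \<phi>) - s M)\<^sup>2"
    proof (rule frac_le)
      show "dirichlet v \<le> (sqrt (dirichlet \<phi>) + s M)\<^sup>2" using power_mono[OF v2, of 2] nn by simp
      show "(sqrt (sqint \<phi>) - s M)\<^sup>2 \<le> sqint v" using power_mono[OF sv(2), of 2] sv(1) nn by simp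
    qed (use nn sv in auto)
    finally show ?thesis by (simp add: ennreal_leI)
  qed
  have "(\<lambda>M. sqrt (C * (1 / real (Suc M)))) \<longlonglongrightarrow> sqrt (C * 0)"
    by (intro tendsto_intros LIMSEQ_Suc[OF lim_1_over_n])
  then have s0: "s \<longlonglongrightarrow> 0" unfolding s_def by simp
  have "(\<lambda>M. (sqrt (dirichlet \<phi>) + s M)\<^sup>2 / (sqrt (sqint \<phi>) - s M)\<^sup>2) \<longlonglongrightarrow>
      (sqrt (dirichlet \<phi>) + 0)\<^sup>2 / (sqrt (sqint \<phi>) - 0)\<^sup>2"
    by (intro tendsto_intros s0) (use pos in simp)
  then have "(\<lambda>M. ennreal ((sqrt (dirichlet \<phi>) + s M)\<^sup>2 / (sqrt (sqint \<phi>) - s M)\<^sup>2)) \<longlonglongrightarrow>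
      ennreal (dirichlet \<phi> / sqint \<phi>)"
    using pos by (intro tendsto_ennrealI) (simp add: dirichlet_def)
  moreover have "\<forall>\<^sub>F M in sequentially. \<lambda>\<^sub>1 D * ennreal (r\<^sup>2) \<le>
      ennreal ((sqrt (dirichlet \<phi>) + s M)\<^sup>2 / (sqrt (sqint \<phi>) - s M)\<^sup>2)"
    using order_tendstoD(2)[OF s0, of "sqrt (sqint \<phi>)"] pos bound by (auto elim: eventually_mono)
  ultimately show "\<lambda>\<^sub>1 D * ennreal (r\<^sup>2) \<le> ennreal (dirichlet \<phi> / sqint \<phi>)"
    by (intro tendsto_lowerbound) auto
qed simp

theorem corollary1p4:
  fixes D :: "(real ^ 'n) set"
  assumes "CARD('n) \<ge> 3"
    and "open D"
    and "\<rho> D < \<infinity>"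
  shows "\<lambda>\<^sub>1 D \<le> \<lambda>\<^sub>1 (ball (0 :: real ^ 'n) 1) * inverse ((\<rho> D)\<^sup>2)"
proof (cases "\<rho> D = 0")
  case True
  \<comment> \<open>The right-hand side is a multiple of \<infinity>. Since 0 * \<infinity> = 0 in
    \<open>ennreal\<close>, positivity of the eigenvalue of the ball is essential. Empty
    \<open>D\<close> falls under this case.\<close>
  then show ?thesis using lambda1_ball_pos[where 'a="real ^ 'n"] by (simp add: ennreal_mult_top)
next
  case False
  let ?B = "\<lambda>\<^sub>1 (ball (0 :: real ^ 'n) 1)"
  define A where "A = {ennreal R | R. R \<ge> 0 \<and> (\<forall>\<epsilon>>0. \<exists>x\<in>D. cap (ball x R \<inter> - D) < ennreal \<epsilon>)}"
  have \<rho>: "\<rho> D = Sup A" by (simp add: A_def strict_cap_inradius_def)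
  have le: "\<lambda>\<^sub>1 D * a\<^sup>2 \<le> ?B" if a: "a \<in> A" for a
  proof -
    obtain R where R: "a = ennreal R" "R \<ge> 0" "\<And>\<epsilon>. \<epsilon> > 0 \<Longrightarrow> \<exists>x\<in>D. cap (ball x R \<inter> - D) < ennreal \<epsilon>"
      using a by (auto simp: A_def)
    show ?thesis
    proof (cases "R = 0")
      case False
      then have "R > 0" using R(2) by simp
      with lambda1_scale_le[OF _ assms(2) this R(3)] assms(1) show ?thesis
        using R(2) by (simp add: R(1) ennreal_power)
    qed (simp add: R(1))
  qed
  have "\<lambda>\<^sub>1 D * (\<rho> D)\<^sup>2 \<le> ?B"
  proof -
    \<comment> \<open>The square of the supremum unfolds into a double supremum of products, because
      constant factors move through suprema in \<open>ennreal\<close>. Each product is at most the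
      square of the larger factor, which again lies in \<open>A\<close>.\<close>
    have "\<lambda>\<^sub>1 D * (a * b) \<le> ?B" if "a \<in> A" "b \<in> A" for a b
    proof -
      have "a * b \<le> (max a b)\<^sup>2" unfolding power2_eq_square by (intro mult_mono) auto
      then have "\<lambda>\<^sub>1 D * (a * b) \<le> \<lambda>\<^sub>1 D * (max a b)\<^sup>2" by (rule mult_left_mono) simp
      also have "\<dots> \<le> ?B" using that by (intro le) (auto simp: max_def)
      finally show ?thesis .
    qed
    moreover have "\<lambda>\<^sub>1 D * (\<rho> D)\<^sup>2 = (SUP a\<in>A. SUP b\<in>A. \<lambda>\<^sub>1 D * (a * b))"
    proof -
      have "(\<rho> D)\<^sup>2 = (SUP a\<in>A. a * Sup A)"
        unfolding \<rho> power2_eq_square using SUP_mult_right_ennreal[of "\<lambda>b. b" A "Sup A"] by simp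
      also have "\<dots> = (SUP a\<in>A. SUP b\<in>A. a * b)"
        using SUP_mult_left_ennreal[of _ "\<lambda>b. b" A] by simp
      finally have "(\<rho> D)\<^sup>2 = (SUP a\<in>A. SUP b\<in>A. a * b)" .
      then show ?thesis by (simp add: SUP_mult_left_ennreal)
    qed
    ultimately show ?thesis by (auto intro!: SUP_least)
  qed
  then have "\<lambda>\<^sub>1 D * (\<rho> D)\<^sup>2 * inverse ((\<rho> D)\<^sup>2) \<le> ?B * inverse ((\<rho> D)\<^sup>2)" by (rule mult_right_mono) simp
  \<comment> \<open>Cancellation in \<open>ennreal\<close> requires a factor that is neither 0 nor
    \<infinity>; finiteness is the hypothesis on the inradius.\<close>
  moreover have "\<lambda>\<^sub>1 D * (\<rho> D)\<^sup>2 * inverse ((\<rho> D)\<^sup>2) = \<lambda>\<^sub>1 D"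
    using mult_divide_eq_ennreal[of "(\<rho> D)\<^sup>2" "\<lambda>\<^sub>1 D"] False assms(3)
    by (simp add: divide_ennreal_def power_eq_top_ennreal less_top)
  ultimately show ?thesis by simp
qed

end
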